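(* Let $f$ be an exact symplectic $C^1$ twist map of $\mathbb{A}$ and let $\mathcal{C}$ be a $C^1$ invariant curve which is a graph (over $\mathbb{T}$) such that $f_{|\mathcal{C}}$ is $C^1$ conjugate to a rotation. Let $W$ be a neighbourhood of $T^1\mathcal{C}$, the unitary tangent bundle to $\mathcal{C}$, in $T^1\mathbb{A}$, the unitary tangent bundle to $\mathbb{A}$. Then there exists a neighbourhood $V$ of $\mathcal{C}$ in $\mathbb{A}$ such that for every Aubry-Mather set $M$ for $f$ contained in $V$: $$\forall x\in M,\quad P^1_M(x)\subset W,$$ where $P^1_M(x)$ is the unitary paratingent cone to $M$ at $x$.
   Context: $\mathbb{T}=\mathbb{R}/\mathbb{Z}$, $\mathbb{A}=\mathbb{T}\times\mathbb{R}$ with coordinates $(\theta,r)$, symplectic form $d\theta\wedge dr$ and its usual Riemannian metric. $\tilde\pi:\mathbb{R}^2\to\mathbb{R}$ is the first projection, $p:\mathbb{R}^2\to\mathbb{A}$ the universal covering. A $C^1$ diffeomorphism $f:\mathbb{A}\to\mathbb{A}$ isotopic to the identity is a positive twist map if, for any lift $\tilde f:\mathbb{R}^2\to\mathbb{R}^2$ and every $\tilde\theta\in\mathbb{R}$, the maps $r\mapsto\tilde\pi\circ\tilde f(\tilde\theta,r)$ and $r\mapsto\tilde\pi\circ\tilde f^{-1}(\tilde\theta,r)$ are both diffeomorphisms (of $\mathbb{R}$), the first increasing and the second decreasing. If $f$ is a positive twist map, $f^{-1}$ is a negative twist map. A twist map may be positive or negative. $f$ is exact symplectic if the 1-form $f^*(r\,d\theta)-r\,d\theta$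 is exact. A non-empty set $M\subset\mathbb{A}$ is $f$-ordered if it is compact, $f$-invariant, and for all $z,z'\in p^{-1}(M)$: $\tilde\pi(z)<\tilde\pi(z')\Leftrightarrow\tilde\pi(\tilde f(z))<\tilde\pi(\tilde f(z'))$. An Aubry-Mather set of $f$ is a minimal (for inclusion) $f$-ordered set. For $M\subset\mathbb{A}$ and $x\in M$, the paratingent cone $P_M(x)\subset T_x\mathbb{A}$ is the set of limits $v=\lim_{n\to\infty}\frac{x_n-y_n}{t_n}$ where $(x_n),(y_n)$ are sequences in $M$ converging to $x$, $(t_n)$ is a sequence of positive reals converging to $0$, and $x_n-y_n$ denotes the lift in $[-\frac12,\frac12[^2\subset\mathbb{R}^2$. The unitary paratingent cone $P^1_M(x)$ is the set of unit vectors of $P_M(x)$. *)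

theory Defs
  imports "HOL-Analysis.Analysis"
begin

section \<open>The circle and the annulus\<close>

quotient_type circle = real / "\<lambda>x y::real. x - y \<in> \<int>"
  morphisms rep_circle circle_of
proof (rule equivpI)
  show "reflp (\<lambda>x y::real. x - y \<in> \<int>)"
    by (simp add: reflp_def)
  show "symp (\<lambda>x y::real. x - y \<in> \<int>)"
    by (metis (mono_tags, lifting) sympI Ints_minus minus_diff_eq)
  show "transp (\<lambda>x y::real. x - y \<in> \<int>)"
  proof (rule transpI)
    fix x y z :: real assume "x - y \<in> \<int>" "y - z \<in> \<int>"
    then have "(x - y) + (y - z) \<in> \<int>" by (rule Ints_add)
    then show "x - z \<in> \<int>" by simp
  qed
qed

lemma circle_of_eq_iff: "circle_of x = circle_of y \<longleftrightarrow> x - y \<in> \<int>"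
  by (rule circle.abs_eq_iff)

lemma ex_circle_of: "\<exists>a. x = circle_of a"
  by (induct x rule: circle.abs_induct) blast

instantiation circle :: ab_group_add
begin

lift_definition zero_circle :: circle is 0 .

lift_definition plus_circle :: "circle \<Rightarrow> circle \<Rightarrow> circle" is "(+)"
proof -
  fix a b c d :: real assume "a - b \<in> \<int>" "c - d \<in> \<int>"
  then have "(a - b) + (c - d) \<in> \<int>" by (rule Ints_add)
  then show "a + c - (b + d) \<in> \<int>" by (simp add: algebra_simps)
qed

lift_definition uminus_circle :: "circle \<Rightarrow> circle" is uminus
proof -
  fix a b :: real assume "a - b \<in> \<int>"
  then have "- (a - b) \<in> \<int>" by (rule Ints_minus)
  then show "- a - - b \<in> \<int>" by simp
qed

lift_definition minus_circle :: "circle \<Rightarrow> circle \<Rightarrow> circle" is "(-)"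
proof -
  fix a b c d :: real assume "a - b \<in> \<int>" "c - d \<in> \<int>"
  then have "(a - b) - (c - d) \<in> \<int>" by (rule Ints_diff)
  then show "a - c - (b - d) \<in> \<int>" by (simp add: algebra_simps)
qed

instance
  by standard (transfer; simp add: algebra_simps)+

end

lemma abs_diff_round_shift:
  fixes a b :: real
  assumes "a - b \<in> \<int>"
  shows "\<bar>a - of_int (round a)\<bar> = \<bar>b - of_int (round b)\<bar>"
proof -
  obtain k where k: "a - b = of_int k" using assms by (auto elim: Ints_cases)
  then have a: "a = b + of_int k" by simp
  have 1: "\<bar>a - of_int (round a)\<bar> \<le> \<bar>a - of_int (round b + k)\<bar>"
    by (rule round_diff_minimal)
  have 2: "\<bar>b - of_int (round b)\<bar> \<le> \<bar>b - of_int (round a - k)\<bar>"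
    by (rule round_diff_minimal)
  from 1 2 a show ?thesis by simp
qed

instantiation circle :: metric_space
begin

text \<open>The quotient of the Euclidean metric: the distance from \<open>x - y\<close> to the nearest integer.\<close>

lift_definition dist_circle :: "circle \<Rightarrow> circle \<Rightarrow> real"
  is "\<lambda>x y. \<bar>x - y - of_int (round (x - y))\<bar>"
proof -
  fix a b c d :: real assume "a - b \<in> \<int>" "c - d \<in> \<int>"
  then have "(a - b) - (c - d) \<in> \<int>" by (rule Ints_diff)
  then have "(a - c) - (b - d) \<in> \<int>" by (simp add: algebra_simps)
  then show "\<bar>a - c - of_int (round (a - c))\<bar> = \<bar>b - d - of_int (round (b - d))\<bar>"
    by (rule abs_diff_round_shift)
qed

definition uniformity_circle :: "(circle \<times> circle) filter"
  where "uniformity_circle = (INF e\<in>{0 <..}. principal {(x, y). dist x y < e})"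

definition open_circle :: "circle set \<Rightarrow> bool"
  where "open_circle U \<longleftrightarrow> (\<forall>x\<in>U. \<forall>\<^sub>F (x', y) in uniformity. x' = x \<longrightarrow> y \<in> U)"

instance
proof
  fix x y z :: circle and U :: "circle set"
  show "uniformity = (INF e\<in>{0 <..}. principal {(x::circle, y). dist x y < e})"
    by (rule uniformity_circle_def)
  show "open U \<longleftrightarrow> (\<forall>x\<in>U. \<forall>\<^sub>F (x', y) in uniformity. x' = x \<longrightarrow> y \<in> U)"
    by (rule open_circle_def)
  show "dist x y = 0 \<longleftrightarrow> x = y"
  proof (transfer, rule iffI)
    fix a b :: real
    assume "\<bar>a - b - of_int (round (a - b))\<bar> = 0"
    then have "a - b = of_int (round (a - b))" by simp
    then show "a - b \<in> \<int>" by (metis Ints_of_int)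
  next
    fix a b :: real
    assume "a - b \<in> \<int>"
    then show "\<bar>a - b - of_int (round (a - b))\<bar> = 0" by (auto elim: Ints_cases)
  qed
  show "dist x y \<le> dist x z + dist y z"
  proof transfer
    fix a b c :: real
    have "\<bar>a - b - of_int (round (a - b))\<bar>
        \<le> \<bar>a - b - of_int (round (a - c) - round (b - c))\<bar>"
      by (rule round_diff_minimal)
    then show "\<bar>a - b - of_int (round (a - b))\<bar>
        \<le> \<bar>a - c - of_int (round (a - c))\<bar> + \<bar>b - c - of_int (round (b - c))\<bar>"
      by simp
  qed
qed

end

lemma dist_circle_of: "dist (circle_of x) (circle_of y) = \<bar>x - y - of_int (round (x - y))\<bar>"
  by (rule dist_circle.abs_eq)

text \<open>The metric induces the quotient topology.\<close>

lemma open_circle_iff: "open U \<longleftrightarrow> open (circle_of -` U)"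
proof
  have le: "dist (circle_of x) (circle_of y) \<le> dist x y" for x y :: real
    using round_diff_minimal[of "x - y" 0] by (simp add: dist_circle_of dist_real_def)
  assume U: "open U"
  show "open (circle_of -` U)"
    unfolding open_dist
  proof
    fix x assume "x \<in> circle_of -` U"
    then obtain e where "e > 0" "\<forall>y. dist y (circle_of x) < e \<longrightarrow> y \<in> U"
      using U unfolding open_dist by blast
    then show "\<exists>e>0. \<forall>y. dist y x < e \<longrightarrow> y \<in> circle_of -` U"
      using le by (metis le_less_trans vimageI)
  qed
next
  assume U: "open (circle_of -` U)"
  show "open U"
    unfolding open_dist
  proof
    fix x assume x: "x \<in> U"
    obtain a where a: "x = circle_of a" using ex_circle_of by blast
    then obtain e where e: "e > 0" "\<And>b. dist b a < e \<Longrightarrow> circle_of b \<in> U"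
      using U x unfolding open_dist by auto
    have "y \<in> U" if "dist y x < e" for y
    proof -
      obtain b where b: "y = circle_of b" using ex_circle_of by blast
      define c where "c = b - of_int (round (b - a))"
      have "circle_of c = y" by (simp add: b c_def circle_of_eq_iff)
      moreover have "dist c a < e"
        using that by (simp add: a b c_def dist_circle_of dist_real_def algebra_simps)
      ultimately show ?thesis using e(2) by blast
    qed
    then show "\<exists>e>0. \<forall>y. dist y x < e \<longrightarrow> y \<in> U" using e(1) by blast
  qed
qed

text \<open>The representative of a point of the circle in \<open>[-1/2, 1/2)\<close>.\<close>

lift_definition circle_lift :: "circle \<Rightarrow> real" is "\<lambda>x. x - of_int \<lfloor>x + 1/2\<rfloor>"
proof -
  fix a b :: real assume "a - b \<in> \<int>"
  then obtain k where "a - b = of_int k" by (auto elim: Ints_cases)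
  then have "a = b + of_int k" by simp
  moreover have "\<lfloor>b + of_int k + 1/2\<rfloor> = \<lfloor>b + 1/2\<rfloor> + k" by linarith
  ultimately show "a - of_int \<lfloor>a + 1/2\<rfloor> = b - of_int \<lfloor>b + 1/2\<rfloor>" by simp
qed

lemma circle_lift_bounds: "circle_lift x \<in> {-1/2..<1/2}"
proof transfer
  fix a :: real
  show "a - of_int \<lfloor>a + 1/2\<rfloor> \<in> {-1/2..<1/2}"
    unfolding atLeastLessThan_iff by linarith
qed

lemma circle_of_circle_lift: "circle_of (circle_lift x) = x"
proof -
  obtain a where "x = circle_of a" using ex_circle_of by blast
  then show ?thesis by (simp add: circle_lift.abs_eq circle_of_eq_iff)
qed

type_synonym annulus = "circle \<times> real"

definition cover :: "real \<times> real \<Rightarrow> annulus"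
  where "cover z = (circle_of (fst z), snd z)"

text \<open>Used for differences of sequences with a common limit: their second coordinate tends
  to 0, so only the first one needs a representative in \<open>[-1/2, 1/2)\<close>.\<close>

definition annulus_lift :: "annulus \<Rightarrow> real \<times> real"
  where "annulus_lift z = (circle_lift (fst z), snd z)"


section \<open>Maps of class C1\<close>

definition C1_map :: "('a::real_normed_vector \<Rightarrow> 'b::real_normed_vector) \<Rightarrow> bool"
  where "C1_map g \<longleftrightarrow>
    (\<exists>g' :: 'a \<Rightarrow> 'a \<Rightarrow>\<^sub>L 'b. (\<forall>x. (g has_derivative blinfun_apply (g' x)) (at x)) \<and>
      continuous_on UNIV g')"

definition C1_diffeo :: "('a::real_normed_vector \<Rightarrow> 'b::real_normed_vector) \<Rightarrow> bool"
  where "C1_diffeo g \<longleftrightarrow> bij g \<and> C1_map g \<and> C1_map (inv g)"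

definition is_lift :: "(real \<times> real \<Rightarrow> real \<times> real) \<Rightarrow> (annulus \<Rightarrow> annulus) \<Rightarrow> bool"
  where "is_lift F f \<longleftrightarrow> continuous_on UNIV F \<and> (\<forall>z. cover (F z) = f (cover z))"

text \<open>Since \<open>cover\<close> is a local diffeomorphism and the plane is simply connected, a map of the
  annulus is C1 iff it has a C1 lift.\<close>

definition annulus_C1_map :: "(annulus \<Rightarrow> annulus) \<Rightarrow> bool"
  where "annulus_C1_map f \<longleftrightarrow> (\<exists>F. is_lift F f \<and> C1_map F)"

definition annulus_C1_diffeo :: "(annulus \<Rightarrow> annulus) \<Rightarrow> bool"
  where "annulus_C1_diffeo f \<longleftrightarrow> bij f \<and> annulus_C1_map f \<and> annulus_C1_map (inv f)"

text \<open>The isotopy is only required to be a continuous path of homeomorphisms, the weakest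
  of the usual notions.\<close>

definition isotopic_to_id :: "(annulus \<Rightarrow> annulus) \<Rightarrow> bool"
  where "isotopic_to_id f \<longleftrightarrow>
    homotopic_with (homeomorphic_map euclidean euclidean) euclidean euclidean id f"


section \<open>Exact symplectic twist maps\<close>

definition positive_twist_map :: "(annulus \<Rightarrow> annulus) \<Rightarrow> bool"
  where "positive_twist_map f \<longleftrightarrow> annulus_C1_diffeo f \<and> isotopic_to_id f \<and>
    (\<forall>F \<theta>. is_lift F f \<longrightarrow>
      C1_diffeo (\<lambda>r. fst (F (\<theta>, r))) \<and> strict_mono (\<lambda>r. fst (F (\<theta>, r))) \<and>
      C1_diffeo (\<lambda>r. fst (inv F (\<theta>, r))) \<and> monotone (<) (>) (\<lambda>r. fst (inv F (\<theta>, r))))"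

definition negative_twist_map :: "(annulus \<Rightarrow> annulus) \<Rightarrow> bool"
  where "negative_twist_map f \<longleftrightarrow> bij f \<and> positive_twist_map (inv f)"

definition twist_map :: "(annulus \<Rightarrow> annulus) \<Rightarrow> bool"
  where "twist_map f \<longleftrightarrow> positive_twist_map f \<or> negative_twist_map f"

text \<open>The 1-form \<open>f\<^sup>*(r d\<theta>) - r d\<theta>\<close> is the differential of a function \<open>S\<close> on the annulus. Forms
  are written in the global coordinates \<open>(\<theta>, r)\<close>: at \<open>cover z\<close>, the pullback of \<open>r d\<theta>\<close> by \<open>f\<close> maps
  \<open>h\<close> to the second coordinate of \<open>F z\<close> times the first coordinate of \<open>DF z h\<close>.\<close>

definition exact_symplectic :: "(annulus \<Rightarrow> annulus) \<Rightarrow> bool"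
  where "exact_symplectic f \<longleftrightarrow>
    (\<exists>S :: annulus \<Rightarrow> real. \<forall>F z. is_lift F f \<longrightarrow>
      ((\<lambda>w. S (cover w)) has_derivative
        (\<lambda>h. snd (F z) * fst (frechet_derivative F (at z) h) - snd z * fst h)) (at z))"


section \<open>Curves, rotations and tangent spaces\<close>

text \<open>As the circle is compact, an injective immersion is an embedding. Here \<open>E\<close> is a lift of
  \<open>e\<close> to the universal covers.\<close>

definition C1_embedding :: "(circle \<Rightarrow> annulus) \<Rightarrow> bool"
  where "C1_embedding e \<longleftrightarrow> inj e \<and>
    (\<exists>E :: real \<Rightarrow> real \<times> real. (\<forall>t. cover (E t) = e (circle_of t)) \<and> C1_map E \<and>
      (\<forall>t. vector_derivative E (at t) \<noteq> 0))"

definition C1_closed_curve :: "annulus set \<Rightarrow> bool"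
  where "C1_closed_curve C \<longleftrightarrow> (\<exists>e. C1_embedding e \<and> range e = C)"

definition is_graph :: "annulus set \<Rightarrow> bool"
  where "is_graph C \<longleftrightarrow> (\<exists>\<gamma> :: circle \<Rightarrow> real. C = range (\<lambda>\<theta>. (\<theta>, \<gamma> \<theta>)))"

text \<open>A C1 diffeomorphism from the circle onto \<open>C\<close> is a C1 embedding with image \<open>C\<close>.\<close>

definition C1_conjugate_to_rotation :: "(annulus \<Rightarrow> annulus) \<Rightarrow> annulus set \<Rightarrow> bool"
  where "C1_conjugate_to_rotation f C \<longleftrightarrow>
    (\<exists>e \<alpha>. C1_embedding e \<and> range e = C \<and> (\<forall>t. f (e t) = e (t + \<alpha>)))"

text \<open>The tangent bundle of the annulus is trivialised by \<open>(\<theta>, r)\<close>.\<close>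

definition unit_tangent_annulus :: "(annulus \<times> (real \<times> real)) set"
  where "unit_tangent_annulus = UNIV \<times> sphere 0 1"

definition tangent_space :: "annulus set \<Rightarrow> annulus \<Rightarrow> (real \<times> real) set"
  where "tangent_space C x =
    {v. \<exists>c :: real \<Rightarrow> real \<times> real. C1_map c \<and> (\<forall>t. cover (c t) \<in> C) \<and> cover (c 0) = x \<and>
      (c has_vector_derivative v) (at 0)}"

definition unit_tangent_bundle :: "annulus set \<Rightarrow> (annulus \<times> (real \<times> real)) set"
  where "unit_tangent_bundle C = {(x, v). x \<in> C \<and> v \<in> tangent_space C x \<and> norm v = 1}"


section \<open>Aubry-Mather sets and paratingent cones\<close>

definition ordered_set :: "(annulus \<Rightarrow> annulus) \<Rightarrow> annulus set \<Rightarrow> bool"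
  where "ordered_set f M \<longleftrightarrow> M \<noteq> {} \<and> compact M \<and> f ` M = M \<and>
    (\<forall>F. is_lift F f \<longrightarrow> (\<forall>z\<in>cover -` M. \<forall>z'\<in>cover -` M.
      fst z < fst z' \<longleftrightarrow> fst (F z) < fst (F z')))"

definition aubry_mather_set :: "(annulus \<Rightarrow> annulus) \<Rightarrow> annulus set \<Rightarrow> bool"
  where "aubry_mather_set f M \<longleftrightarrow>
    ordered_set f M \<and> (\<forall>N. ordered_set f N \<and> N \<subseteq> M \<longrightarrow> N = M)"

definition paratingent_cone :: "annulus set \<Rightarrow> annulus \<Rightarrow> (real \<times> real) set"
  where "paratingent_cone M x =
    {v. \<exists>X Y :: nat \<Rightarrow> annulus. \<exists>\<tau> :: nat \<Rightarrow> real.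
      (\<forall>n. X n \<in> M) \<and> (\<forall>n. Y n \<in> M) \<and> X \<longlonglongrightarrow> x \<and> Y \<longlonglongrightarrow> x \<and>
      (\<forall>n. \<tau> n > 0) \<and> \<tau> \<longlonglongrightarrow> 0 \<and>
      (\<lambda>n. annulus_lift (X n - Y n) /\<^sub>R \<tau> n) \<longlonglongrightarrow> v}"

definition unit_paratingent_cone :: "annulus set \<Rightarrow> annulus \<Rightarrow> (real \<times> real) set"
  where "unit_paratingent_cone M x = {v \<in> paratingent_cone M x. norm v = 1}"

end

theory Submission
  imports Defs
begin

text \<open>
  Let \<open>F\<close> and \<open>G\<close> be lifts of \<open>f\<close> and its inverse. Since the iterates of \<open>f\<close> preserve the cyclic order
  of an ordered set \<open>M\<close>, the mean value theorem shows that for \<open>v\<close> in a paratingent cone of \<open>M\<close> the first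
  coordinates of all images of \<open>v\<close> under the derivatives of \<open>F\<^sup>k\<close> and \<open>G\<^sup>k\<close> have the same weak sign.
  This condition is closed, so limits of such vectors at points tending to \<open>C\<close> satisfy it too.
  On \<open>C\<close> it forces tangency: the derivative of \<open>f\<close> carries the tangent field coming from the conjugacy
  to itself and has determinant 1, hence is unipotent in a suitable frame, and the twist makes its
  off-diagonal entries of one sign and bounded away from 0. A transverse vector is therefore
  sheared towards opposite sides in the future and in the past. The theorem follows by compactness
  of \<open>C\<close> and of the unit circle.
\<close>

section \<open>Differential calculus\<close>

text \<open>The mean value theorem in direction \<open>v\<close>, applied to the difference of
  \<open>G\<close> along two parallel segments, reduces the second difference to first-order
  increments of \<open>g\<close> near \<open>z0\<close>. Differentiability of \<open>g\<close> at
  the single point \<open>z0\<close> then gives the limit.\<close>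

lemma second_difference_tendsto:
  fixes G :: "'a::real_normed_vector \<Rightarrow> real"
  assumes G: "\<And>z. (G has_derivative g z) (at z)"
    and A: "((\<lambda>z. g z v) has_derivative A) (at z0)"
  shows "((\<lambda>t. (G (z0 + t *\<^sub>R u + t *\<^sub>R v) - G (z0 + t *\<^sub>R u) - G (z0 + t *\<^sub>R v) + G z0) / t\<^sup>2)
    \<longlongrightarrow> A u) (at_right 0)"
proof (rule tendstoI)
  fix e :: real assume e: "e > 0"
  \<comment> \<open>The points on the two segments lie within \<open>t * (norm u + norm v)\<close>
    and \<open>t * norm v\<close> of \<open>z0\<close>, and \<open>K\<close> exceeds the sum of
    these factors. The summand 1 keeps \<open>K\<close> positive when \<open>u\<close> and
    \<open>v\<close> vanish.\<close>
  define K where "K = norm u + 2 * norm v + 1"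
  define \<epsilon> where "\<epsilon> = e / (2 * K)"
  have K: "K > 0" "\<epsilon> > 0" using e by (auto simp: K_def \<epsilon>_def add_nonneg_pos)
  have lin: "bounded_linear A" and "\<forall>e>0. \<exists>d>0. \<forall>y. norm (y - z0) < d \<longrightarrow>
      norm (g y v - g z0 v - A (y - z0)) \<le> e * norm (y - z0)"
    using A unfolding has_derivative_at_alt by auto
  then obtain d where d: "d > 0" and dd: "\<And>y. norm (y - z0) < d \<Longrightarrow>
      \<bar>g y v - g z0 v - A (y - z0)\<bar> \<le> \<epsilon> * norm (y - z0)"
    using K by (metis real_norm_def)
  interpret A: bounded_linear A by fact
  have "\<forall>\<^sub>F t in at_right 0. t < d / K \<and> t > (0::real)"
    using eventually_at_right_real[of 0 "d / K"] d K by (auto elim: eventually_mono)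
  then show "\<forall>\<^sub>F t in at_right 0. dist ((G (z0 + t *\<^sub>R u + t *\<^sub>R v) - G (z0 + t *\<^sub>R u)
      - G (z0 + t *\<^sub>R v) + G z0) / t\<^sup>2) (A u) < e"
  proof (rule eventually_mono)
    fix t assume t: "t < d / K \<and> t > 0"
    let ?p = "\<lambda>s. z0 + t *\<^sub>R u + (s * t) *\<^sub>R v" and ?q = "\<lambda>s. z0 + (s * t) *\<^sub>R v"
    have der: "((\<lambda>s. G (?p s) - G (?q s)) has_derivative
        (\<lambda>k. g (?p s) ((k * t) *\<^sub>R v) - g (?q s) ((k * t) *\<^sub>R v))) (at s)" for s
      by (rule has_derivative_diff; rule has_derivative_compose[OF _ G]; auto intro!: derivative_eq_intros)
    \<comment> \<open>One intermediate parameter serves both segments, so the two points differ by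
      exactly \<open>t *\<^sub>R u\<close> and the linear parts differ by
      \<open>t * A u\<close>.\<close>
    have "\<exists>x\<in>{0<..<1::real}. (G (?p 1) - G (?q 1)) - (G (?p 0) - G (?q 0)) =
        (\<lambda>k. g (?p x) ((k * t) *\<^sub>R v) - g (?q x) ((k * t) *\<^sub>R v)) (1 - 0)"
      by (rule mvt_simple) (auto intro: der has_derivative_at_withinI)
    then obtain \<xi> where \<xi>: "0 < \<xi>" "\<xi> < 1"
      and eq: "(G (?p 1) - G (?q 1)) - (G (?p 0) - G (?q 0)) = g (?p \<xi>) (t *\<^sub>R v) - g (?q \<xi>) (t *\<^sub>R v)"
      by auto
    have sc: "g y (t *\<^sub>R v) = t * g y v" for y
      using G[of y] by (simp add: has_derivative_def linear_simps)
    have np: "norm (?p \<xi> - z0) \<le> t * (norm u + norm v)" "norm (?q \<xi> - z0) \<le> t * norm v"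
    proof -
      have "norm (?p \<xi> - z0) \<le> norm (t *\<^sub>R u) + norm ((\<xi> * t) *\<^sub>R v)"
        by (metis add_diff_cancel_left' add.assoc norm_triangle_ineq)
      moreover have le: "norm ((\<xi> * t) *\<^sub>R v) \<le> t * norm v"
        using \<xi> t by (auto simp: mult_left_le_one_le)
      ultimately show "norm (?p \<xi> - z0) \<le> t * (norm u + norm v)" using t by (simp add: algebra_simps)
      show "norm (?q \<xi> - z0) \<le> t * norm v" using le by simp
    qed
    have tK: "t * K < d" using t K by (simp add: field_simps)
    have "t * (norm u + norm v) \<le> t * K" "t * norm v \<le> t * K" using t by (auto simp: K_def)
    then have "norm (?p \<xi> - z0) < d" "norm (?q \<xi> - z0) < d" using np tK by linarith+
    then have 1: "\<bar>g (?p \<xi>) v - g z0 v - A (?p \<xi> - z0)\<bar> \<le> \<epsilon> * (t * (norm u + norm v))"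
      "\<bar>g (?q \<xi>) v - g z0 v - A (?q \<xi> - z0)\<bar> \<le> \<epsilon> * (t * norm v)"
      using dd np K by (meson mult_left_mono less_imp_le order_trans)+
    have "A (?p \<xi> - z0) - A (?q \<xi> - z0) = t * A u"
      by (simp add: A.add A.scaleR A.diff)
    then have "\<bar>g (?p \<xi>) v - g (?q \<xi>) v - t * A u\<bar> \<le> \<epsilon> * (t * (norm u + norm v)) + \<epsilon> * (t * norm v)"
      using 1 by linarith
    also have "\<dots> = \<epsilon> * t * (norm u + 2 * norm v)" by (simp add: algebra_simps)
    also have "\<dots> < \<epsilon> * t * (2 * K)"
      using t K by (intro mult_strict_left_mono) (auto simp: K_def add_pos_nonneg add_nonneg_pos)
    also have "\<dots> = e * t" using K by (simp add: \<epsilon>_def)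
    finally have "\<bar>g (?p \<xi>) v - g (?q \<xi>) v - t * A u\<bar> < e * t" .
    then have "\<bar>(g (?p \<xi>) v - g (?q \<xi>) v - t * A u) / t\<bar> < e"
      using t by (simp add: abs_divide field_simps)
    moreover have "(G (z0 + t *\<^sub>R u + t *\<^sub>R v) - G (z0 + t *\<^sub>R u) - G (z0 + t *\<^sub>R v) + G z0) / t\<^sup>2 - A u
       = (g (?p \<xi>) v - g (?q \<xi>) v - t * A u) / t"
    proof -
      have "G (z0 + t *\<^sub>R u + t *\<^sub>R v) - G (z0 + t *\<^sub>R u) - G (z0 + t *\<^sub>R v) + G z0
          = t * (g (?p \<xi>) v - g (?q \<xi>) v)"
        using eq by (simp add: sc right_diff_distrib)
      then show ?thesis using t by (simp only:) (simp add: diff_divide_distrib power2_eq_square)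
    qed
    ultimately show "dist ((G (z0 + t *\<^sub>R u + t *\<^sub>R v) - G (z0 + t *\<^sub>R u)
      - G (z0 + t *\<^sub>R v) + G z0) / t\<^sup>2) (A u) < e"
      by (simp add: dist_real_def)
  qed
qed

text \<open>The second difference is symmetric in \<open>u\<close> and \<open>v\<close>, so its
  limits computed in the two orders agree.\<close>

lemma symmetric_second_derivative:
  fixes G :: "'a::real_normed_vector \<Rightarrow> real"
  assumes G: "\<And>z. (G has_derivative g z) (at z)"
    and A: "((\<lambda>z. g z v) has_derivative A) (at z0)"
    and B: "((\<lambda>z. g z u) has_derivative B) (at z0)"
  shows "A u = B v"
proof -
  have "((\<lambda>t. (G (z0 + t *\<^sub>R u + t *\<^sub>R v) - G (z0 + t *\<^sub>R u) - G (z0 + t *\<^sub>R v) + G z0) / t\<^sup>2)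
    \<longlongrightarrow> B v) (at_right 0)"
    using second_difference_tendsto[OF G B, of v] by (simp add: algebra_simps)
  then show ?thesis
    using second_difference_tendsto[OF G A, of u]
    by (intro tendsto_unique[of "at_right (0::real)"]) auto
qed

text \<open>Where \<open>b\<close> vanishes, the term of the product rule with the derivative of
  \<open>c\<close> drops out. Two errors remain: the remainder of \<open>b\<close> times
  \<open>c\<close>, and \<open>b' (y - z)\<close> times the increment of \<open>c\<close>; both are
  of smaller order than \<open>norm (y - z)\<close>.\<close>

lemma has_derivative_mult_zero:
  fixes b c :: "'a::real_normed_vector \<Rightarrow> real"
  assumes b: "(b has_derivative b') (at z)" and b0: "b z = 0" and c: "isCont c z"
  shows "((\<lambda>y. b y * c y) has_derivative (\<lambda>h. b' h * c z)) (at z)"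
proof -
  have lin: "bounded_linear b'" and "((\<lambda>y. (b y - b z - b' (y - z)) /\<^sub>R norm (y - z)) \<longlongrightarrow> 0) (at z)"
    using b unfolding has_derivative_at_within by auto
  then have 1: "((\<lambda>y. (b y - b' (y - z)) /\<^sub>R norm (y - z) * c y) \<longlongrightarrow> 0 * c z) (at z)"
    using c b0 by (intro tendsto_mult) (auto simp: isCont_def)
  obtain K where K: "\<And>h. norm (b' h) \<le> norm h * K" using bounded_linear.bounded[OF lin] by blast
  have c0: "((\<lambda>y. \<bar>K\<bar> * \<bar>c y - c z\<bar>) \<longlongrightarrow> 0) (at z)"
    using c unfolding isCont_def by (auto intro!: tendsto_eq_intros)
  have 2: "((\<lambda>y. b' (y - z) / norm (y - z) * (c y - c z)) \<longlongrightarrow> 0) (at z)"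
  proof (rule Lim_null_comparison[OF _ c0], rule always_eventually, rule allI)
    fix y
    have "\<bar>b' (y - z)\<bar> / norm (y - z) \<le> \<bar>K\<bar>"
    proof (cases "y = z")
      case False
      have "\<bar>b' (y - z)\<bar> \<le> norm (y - z) * \<bar>K\<bar>"
        using K[of "y - z"] by (simp add: order_trans[OF _ mult_left_mono[OF abs_ge_self]])
      then show ?thesis using False by (simp add: field_simps)
    qed simp
    then show "norm (b' (y - z) / norm (y - z) * (c y - c z)) \<le> \<bar>K\<bar> * \<bar>c y - c z\<bar>"
      by (simp only: real_norm_def abs_mult abs_divide abs_norm_cancel mult_right_mono abs_ge_zero)
  qed
  have "((\<lambda>y. (b y * c y - b z * c z - b' (y - z) * c z) /\<^sub>R norm (y - z)) \<longlongrightarrow> 0) (at z)"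
    using tendsto_add[OF 1 2] by (simp add: b0 divide_inverse algebra_simps)
  then show ?thesis
    unfolding has_derivative_at_within using lin bounded_linear_mult_const by blast
qed

section \<open>Calculus of maps of class C1\<close>

abbreviation deriv_at :: "('a::real_normed_vector \<Rightarrow> 'b::real_normed_vector) \<Rightarrow> 'a \<Rightarrow> 'a \<Rightarrow> 'b"
  where "deriv_at g x \<equiv> frechet_derivative g (at x)"

lemma C1_mapE:
  assumes "C1_map g"
  obtains g' where "\<And>x. (g has_derivative blinfun_apply (g' x)) (at x)" "continuous_on UNIV g'"
    "\<And>x. deriv_at g x = blinfun_apply (g' x)"
  using assms unfolding C1_map_def by (metis frechet_derivative_at)

lemma C1_map_has_derivative: "C1_map g \<Longrightarrow> (g has_derivative deriv_at g x) (at x)"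
  by (metis C1_mapE)

lemma C1_map_continuous_on: "C1_map g \<Longrightarrow> continuous_on UNIV g"
  by (meson C1_map_has_derivative has_derivative_continuous_on has_derivative_at_withinI)

text \<open>Joint continuity of the derivative in the point and the vector: convergence of operators
  in norm passes to their values along convergent vectors. All later limits of derivatives rest on
  it.\<close>

lemma C1_map_deriv_tendsto:
  assumes "C1_map g" "(y \<longlongrightarrow> x) A" "(u \<longlongrightarrow> v) A"
  shows "((\<lambda>n. deriv_at g (y n) (u n)) \<longlongrightarrow> deriv_at g x v) A"
proof -
  obtain g' where g': "continuous_on UNIV g'" "\<And>x. deriv_at g x = blinfun_apply (g' x)"
    using assms(1) by (elim C1_mapE) blast
  have "((\<lambda>n. g' (y n)) \<longlongrightarrow> g' x) A"
    using g'(1) assms(2) by (rule continuous_on_tendsto_compose) auto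
  then show ?thesis unfolding g'(2) using assms(3) by (rule tendsto_intros)
qed

lemma deriv_at_linear: "C1_map g \<Longrightarrow> linear (deriv_at g x)"
  using C1_map_has_derivative has_derivative_linear by blast

lemma deriv_at_compose:
  assumes "C1_map g" "C1_map h"
  shows "(g \<circ> h has_derivative (\<lambda>v. deriv_at g (h x) (deriv_at h x v))) (at x)"
  using has_derivative_compose[OF C1_map_has_derivative[OF assms(2)] C1_map_has_derivative[OF assms(1)]]
  by (simp add: o_def)

lemma C1_map_compose:
  assumes "C1_map g" "C1_map h"
  shows "C1_map (g \<circ> h)"
proof -
  obtain g' where g': "continuous_on UNIV g'" "\<And>x. deriv_at g x = blinfun_apply (g' x)"
    using assms(1) by (elim C1_mapE) blast
  obtain h' where h': "continuous_on UNIV h'" "\<And>x. deriv_at h x = blinfun_apply (h' x)"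
    using assms(2) by (elim C1_mapE) blast
  have "continuous_on UNIV (\<lambda>x. g' (h x) o\<^sub>L h' x)"
    using continuous_on_compose2[OF g'(1) C1_map_continuous_on[OF assms(2)]] h'(1)
    by (intro continuous_intros) auto
  moreover have "blinfun_apply (g' (h x) o\<^sub>L h' x) = (\<lambda>v. deriv_at g (h x) (deriv_at h x v))" for x
    by (simp add: fun_eq_iff g'(2) h'(2))
  then have "(g \<circ> h has_derivative blinfun_apply (g' (h x) o\<^sub>L h' x)) (at x)" for x
    using deriv_at_compose[OF assms, of x] by simp
  ultimately show ?thesis
    unfolding C1_map_def by (intro exI[of _ "\<lambda>x. g' (h x) o\<^sub>L h' x"] conjI allI)
qed

lemma C1_map_id: "C1_map id"
  unfolding C1_map_def id_def
  by (intro exI[of _ "\<lambda>x. id_blinfun"]) (auto intro: has_derivative_ident)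

lemma C1_map_funpow:
  fixes g :: "'a::real_normed_vector \<Rightarrow> 'a"
  shows "C1_map g \<Longrightarrow> C1_map (g ^^ k)"
proof (induction k)
  case 0
  show ?case by (simp only: funpow.simps C1_map_id)
next
  case (Suc k)
  then show ?case by (simp only: funpow.simps C1_map_compose)
qed

lemma C1_map_affine: "C1_map (\<lambda>s::real. c + s *\<^sub>R v)"
  unfolding C1_map_def
  by (intro exI[of _ "\<lambda>x. blinfun_scaleR_left v"]) (auto intro!: derivative_eq_intros)

section \<open>Exact maps and the area form\<close>

text \<open>This is the symplectic form, the wedge product of the differentials of the angle and of
  \<open>r\<close>, evaluated on two vectors.\<close>

definition area :: "real \<times> real \<Rightarrow> real \<times> real \<Rightarrow> real"
  where "area u v = fst u * snd v - snd u * fst v"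

text \<open>Subtracting its linear part at \<open>z\<^sub>0\<close> from a primitive \<open>S\<close> makes its differential differentiable
  at \<open>z\<^sub>0\<close>, although \<open>F\<close> has only one derivative.\<close>

lemma exact_area_preserving:
  fixes F :: "real \<times> real \<Rightarrow> real \<times> real"
  assumes F: "C1_map F"
    and S: "\<And>z. (S has_derivative (\<lambda>h. snd (F z) * fst (deriv_at F z h) - snd z * fst h)) (at z)"
  shows "area (deriv_at F z0 u) (deriv_at F z0 v) = area u v"
proof -
  define P where "P z = S z - snd (F z0) * fst (F z) + snd z0 * fst z" for z
  \<comment> \<open>In this differential of \<open>P\<close>, the factors in front of the derivative
    of \<open>F\<close> and of \<open>fst h\<close> vanish at \<open>z0\<close>, so
    \<open>has_derivative_mult_zero\<close> applies to the first product.\<close>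
  define g where "g z h = (snd (F z) - snd (F z0)) * fst (deriv_at F z h) - (snd z - snd z0) * fst h" for z h
  note D = C1_map_has_derivative[OF F]
  have P: "(P has_derivative g z) (at z)" for z
    unfolding P_def g_def
    by (rule has_derivative_eq_rhs, (rule derivative_eq_intros S D | simp)+) (auto simp: algebra_simps)
  have g: "((\<lambda>z. g z h) has_derivative (\<lambda>k. snd (deriv_at F z0 k) * fst (deriv_at F z0 h) - snd k * fst h))
      (at z0)" for h
    unfolding g_def
  proof (rule has_derivative_diff)
    have "isCont (\<lambda>z. fst (deriv_at F z h)) z0"
      unfolding isCont_def by (intro tendsto_intros C1_map_deriv_tendsto[OF F])
    moreover have "((\<lambda>z. snd (F z) - snd (F z0)) has_derivative (\<lambda>k. snd (deriv_at F z0 k))) (at z0)"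
      by (auto intro!: derivative_eq_intros D)
    ultimately show "((\<lambda>z. (snd (F z) - snd (F z0)) * fst (deriv_at F z h)) has_derivative
        (\<lambda>k. snd (deriv_at F z0 k) * fst (deriv_at F z0 h))) (at z0)"
      by (intro has_derivative_mult_zero) auto
    show "((\<lambda>z. (snd z - snd z0) * fst h) has_derivative (\<lambda>k. snd k * fst h)) (at z0)"
      by (auto intro!: derivative_eq_intros)
  qed
  have "snd (deriv_at F z0 u) * fst (deriv_at F z0 v) - snd u * fst v =
      snd (deriv_at F z0 v) * fst (deriv_at F z0 u) - snd v * fst u"
    by (rule symmetric_second_derivative[OF P g g])
  then show ?thesis by (simp add: area_def algebra_simps)
qed

section \<open>Lifts and paratingent cones\<close>

lemma circle_of_frac: "circle_of (frac t) = circle_of t"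
  unfolding circle_of_eq_iff frac_def by simp

lemma circle_of_add: "circle_of (s + t) = circle_of s + circle_of t"
  by (simp add: plus_circle.abs_eq)

lemma cover_add: "cover (z + w) = cover z + cover w"
  by (simp add: cover_def circle_of_add)

lemma cover_annulus_lift: "cover (annulus_lift x) = x"
  by (simp add: cover_def annulus_lift_def circle_of_circle_lift)

lemma dist_circle_eq_abs_lift: "dist x y = \<bar>circle_lift (x - y)\<bar>"
proof -
  have "dist (circle_of a) (circle_of b) = \<bar>circle_lift (circle_of a - circle_of b)\<bar>" for a b
    unfolding dist_circle_of minus_circle.abs_eq circle_lift.abs_eq round_def ..
  then show ?thesis using ex_circle_of[of x] ex_circle_of[of y] by fast
qed

lemma norm_annulus_lift: "norm (annulus_lift (x - y)) = dist x y"
  by (simp add: annulus_lift_def norm_prod_def dist_prod_def dist_circle_eq_abs_lift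
      dist_real_def)

lemma continuous_cover: "continuous_on UNIV cover"
proof -
  have "dist (circle_of a) (circle_of b) \<le> dist a b" for a b
    using round_diff_minimal[of "a - b" 0] by (simp add: dist_circle_of dist_real_def)
  then have "dist (cover z) (cover w) \<le> dist z w" for z w
    by (simp add: cover_def dist_prod_def power_mono)
  then show ?thesis
    unfolding continuous_on_iff by (blast intro: le_less_trans)
qed

lemma tendsto_cover: "(z \<longlongrightarrow> w) A \<Longrightarrow> ((\<lambda>n. cover (z n)) \<longlongrightarrow> cover w) A"
  using continuous_cover by (rule continuous_on_tendsto_compose) auto

text \<open>The lift of \<open>X n\<close> chosen here lies at distance
  \<open>dist (X n) (cover z)\<close> from \<open>z\<close>. Convergence in the annulus thus becomes
  convergence to a prescribed preimage of the limit.\<close>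

lemma tendsto_lift_near:
  assumes "X \<longlonglongrightarrow> cover z"
  shows "(\<lambda>n. z + annulus_lift (X n - cover z)) \<longlonglongrightarrow> z"
proof -
  have "(\<lambda>n. norm (annulus_lift (X n - cover z))) \<longlonglongrightarrow> 0"
    unfolding norm_annulus_lift using assms tendsto_dist_iff by blast
  then have "(\<lambda>n. z + annulus_lift (X n - cover z)) \<longlonglongrightarrow> z + 0"
    by (rule tendsto_add[OF tendsto_const tendsto_norm_zero_cancel])
  then show ?thesis by simp
qed

text \<open>The difference of the first coordinates is continuous and integer-valued on a connected
  space, and the second coordinates agree.\<close>

lemma lifts_differ_by_constant:
  fixes H1 H2 :: "'a::real_normed_vector \<Rightarrow> real \<times> real"
  assumes "continuous_on UNIV H1" "continuous_on UNIV H2" and eq: "\<And>z. cover (H1 z) = cover (H2 z)"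
  obtains c where "\<And>z. H1 z = H2 z + c"
proof -
  have int: "fst (H1 z) - fst (H2 z) \<in> \<int>" and snd: "snd (H1 z) = snd (H2 z)" for z
    using eq[of z] by (auto simp: cover_def circle_of_eq_iff)
  have "(\<lambda>z. fst (H1 z) - fst (H2 z)) constant_on UNIV"
  proof (rule continuous_discrete_range_constant)
    show "continuous_on UNIV (\<lambda>z. fst (H1 z) - fst (H2 z))"
      using assms by (intro continuous_intros)
    show "\<exists>e>0. \<forall>y. y \<in> UNIV \<and> fst (H1 y) - fst (H2 y) \<noteq> fst (H1 x) - fst (H2 x) \<longrightarrow>
        e \<le> norm (fst (H1 y) - fst (H2 y) - (fst (H1 x) - fst (H2 x)))" for x
      using Ints_nonzero_abs_ge1[OF Ints_diff[OF int int]] by (intro exI[of _ 1]) auto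
  qed (rule convex_connected[OF convex_UNIV])
  then obtain k where "\<And>z. fst (H1 z) - fst (H2 z) = k" unfolding constant_on_def by auto
  then have "H1 z = H2 z + (k, 0)" for z using snd[of z] by (simp add: prod_eq_iff algebra_simps)
  then show ?thesis using that by blast
qed

text \<open>Derivatives do not see translations. Identities known only after projection to the
  annulus can thereby be differentiated in the plane.\<close>

lemma lifts_same_derivative:
  fixes H1 H2 :: "'a::real_normed_vector \<Rightarrow> real \<times> real"
  assumes "continuous_on UNIV H1" "continuous_on UNIV H2" and "\<And>z. cover (H1 z) = cover (H2 z)"
    and D: "(H1 has_derivative D1) (at z)" "(H2 has_derivative D2) (at z)"
  shows "D1 = D2"
proof -
  obtain c where c: "\<And>z. H1 z = H2 z + c" using lifts_differ_by_constant assms(1-3) by blast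
  have "((\<lambda>z. H2 z + c) has_derivative D2) (at z)" by (auto intro!: derivative_eq_intros D)
  moreover have "H1 = (\<lambda>z. H2 z + c)" using c by blast
  ultimately have "(H1 has_derivative D2) (at z)" by simp
  then show ?thesis using D has_derivative_unique by blast
qed

text \<open>First \<open>Y n\<close> is lifted to \<open>b n\<close> near \<open>z\<close>, then
  \<open>X n\<close> is lifted relative to \<open>b n\<close>. This makes \<open>a n - b n\<close>
  exactly the representative used in the definition of the cone.\<close>

lemma paratingent_cone_lifts:
  assumes "v \<in> paratingent_cone M (cover z)"
  obtains a b :: "nat \<Rightarrow> real \<times> real" and \<tau> :: "nat \<Rightarrow> real"
  where "\<And>n. cover (a n) \<in> M" "\<And>n. cover (b n) \<in> M" "a \<longlonglongrightarrow> z" "b \<longlonglongrightarrow> z" "\<And>n. \<tau> n > 0"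
    "(\<lambda>n. (a n - b n) /\<^sub>R \<tau> n) \<longlonglongrightarrow> v"
proof -
  obtain X Y \<tau> where XY: "\<And>n. X n \<in> M" "\<And>n. Y n \<in> M" "X \<longlonglongrightarrow> cover z" "Y \<longlonglongrightarrow> cover z"
    and \<tau>: "\<And>n. \<tau> n > 0" and lim: "(\<lambda>n. annulus_lift (X n - Y n) /\<^sub>R \<tau> n) \<longlonglongrightarrow> v"
    using assms unfolding paratingent_cone_def by blast
  define b where "b n = z + annulus_lift (Y n - cover z)" for n
  define a where "a n = b n + annulus_lift (X n - Y n)" for n
  have b: "b \<longlonglongrightarrow> z" unfolding b_def by (rule tendsto_lift_near[OF XY(4)])
  have cb: "cover (b n) = Y n" for n
    unfolding b_def cover_add cover_annulus_lift by simp
  have ca: "cover (a n) = X n" for n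
    unfolding a_def cb cover_add cover_annulus_lift by simp
  have "(\<lambda>n. dist (X n) (Y n)) \<longlonglongrightarrow> 0" using tendsto_dist[OF XY(3,4)] by simp
  then have "(\<lambda>n. annulus_lift (X n - Y n)) \<longlonglongrightarrow> 0"
    unfolding norm_annulus_lift[symmetric] by (rule tendsto_norm_zero_cancel)
  then have "a \<longlonglongrightarrow> z + 0" unfolding a_def by (intro tendsto_intros b)
  moreover have "a n - b n = annulus_lift (X n - Y n)" for n by (simp add: a_def)
  ultimately show ?thesis
    using XY(1,2) b ca cb \<tau> lim by (intro that[of a b \<tau>]) simp_all
qed

text \<open>On the segment from \<open>b n\<close> to \<open>a n\<close>, the mean value theorem
  writes the increment of the first coordinate of \<open>H\<close> as a derivative at a point
  tending to \<open>z\<close>. If the limit of these derivatives, rescaled by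
  \<open>\<tau> n\<close>, were negative, the increments would eventually be negative too.\<close>

lemma deriv_fst_nonneg:
  fixes H :: "real \<times> real \<Rightarrow> real \<times> real"
  assumes H: "C1_map H" and a: "a \<longlonglongrightarrow> z" and b: "b \<longlonglongrightarrow> z" and \<tau>: "\<And>n. \<tau> n > 0"
    and v: "(\<lambda>n. (a n - b n) /\<^sub>R \<tau> n) \<longlonglongrightarrow> v"
    and freq: "\<exists>\<^sub>F n in sequentially. fst (H (b n)) \<le> fst (H (a n))"
  shows "0 \<le> fst (deriv_at H z v)"
proof (rule ccontr)
  assume "\<not> ?thesis"
  then have neg: "fst (deriv_at H z v) < 0" by simp
  have der: "((\<lambda>s. fst (H (b n + s *\<^sub>R (a n - b n)))) has_derivative
      (\<lambda>k. fst (deriv_at H (b n + s *\<^sub>R (a n - b n)) (k *\<^sub>R (a n - b n))))) (at s)" for n s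
  proof -
    have "((\<lambda>s. b n + s *\<^sub>R (a n - b n)) has_derivative (\<lambda>k. k *\<^sub>R (a n - b n))) (at s)"
      by (auto intro!: derivative_eq_intros)
    from has_derivative_fst[OF has_derivative_compose[OF this C1_map_has_derivative[OF H]]]
    show ?thesis .
  qed
  have "\<exists>s\<in>{0<..<1::real}. fst (H (b n + 1 *\<^sub>R (a n - b n))) - fst (H (b n + 0 *\<^sub>R (a n - b n))) =
     fst (deriv_at H (b n + s *\<^sub>R (a n - b n)) ((1 - 0) *\<^sub>R (a n - b n)))" for n
    by (rule mvt_simple) (simp, rule has_derivative_at_withinI[OF der])
  then have "\<exists>s. s \<in> {0<..<1::real} \<and> fst (H (a n)) - fst (H (b n)) =
     fst (deriv_at H (b n + s *\<^sub>R (a n - b n)) (a n - b n))" for n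
    by (fastforce)
  then obtain s where s: "\<And>n. s n \<in> {0<..<1::real}" and eq: "\<And>n. fst (H (a n)) - fst (H (b n)) =
     fst (deriv_at H (b n + s n *\<^sub>R (a n - b n)) (a n - b n))"
    by metis
  have ab: "(\<lambda>n. a n - b n) \<longlonglongrightarrow> 0" using tendsto_diff[OF a b] by simp
  have "(\<lambda>n. s n *\<^sub>R (a n - b n)) \<longlonglongrightarrow> 0"
  proof (rule Lim_null_comparison[OF always_eventually tendsto_norm_zero[OF ab]], rule allI)
    fix n show "norm (s n *\<^sub>R (a n - b n)) \<le> norm (a n - b n)"
      using s[of n] by (auto simp: mult_left_le_one_le)
  qed
  from tendsto_add[OF b this] have "(\<lambda>n. b n + s n *\<^sub>R (a n - b n)) \<longlonglongrightarrow> z" by simp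
  from tendsto_fst[OF C1_map_deriv_tendsto[OF H this v]]
  have "\<forall>\<^sub>F n in sequentially. fst (deriv_at H (b n + s n *\<^sub>R (a n - b n)) ((a n - b n) /\<^sub>R \<tau> n)) < 0"
    using neg order_tendstoD(2) by blast
  then have "\<forall>\<^sub>F n in sequentially. \<not> fst (H (b n)) \<le> fst (H (a n))"
  proof eventually_elim
    case (elim n)
    then have "inverse (\<tau> n) * (fst (H (a n)) - fst (H (b n))) < 0"
      by (simp add: eq linear_scale[OF deriv_at_linear[OF H]])
    then show ?case using \<tau>[of n] by (simp add: mult_less_0_iff)
  qed
  then show False using freq unfolding frequently_def by blast
qed

section \<open>Lifts of the map and of its inverse\<close>

text \<open>\<open>G\<close> lifts the inverse of \<open>f\<close>, but need not be the inverse of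
  \<open>F\<close>: their composition is a translation. The assumptions are symmetric under
  exchanging \<open>F\<close> and \<open>G\<close>, so each result about the future also yields one
  about the past.\<close>

locale lifted_map =
  fixes f :: "annulus \<Rightarrow> annulus" and F G :: "real \<times> real \<Rightarrow> real \<times> real"
  assumes bij: "bij f" and F: "C1_map F" and G: "C1_map G"
    and lift_F: "is_lift F f" and lift_G: "is_lift G (inv f)"
    and area_F: "\<And>z u v. area (deriv_at F z u) (deriv_at F z v) = area u v"
begin

lemma cover_F: "cover (F z) = f (cover z)"
  using lift_F unfolding is_lift_def by blast

lemma cover_G: "cover (G z) = inv f (cover z)"
  using lift_G unfolding is_lift_def by blast

lemma cover_FG: "cover (F (G z)) = cover z"
  using bij by (simp add: cover_F cover_G bij_is_surj surj_f_inv_f)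

lemma cover_GF: "cover (G (F z)) = cover z"
  using bij by (simp add: cover_F cover_G bij_is_inj inv_f_f)

lemma deriv_FG: "deriv_at F (G z) (deriv_at G z v) = v"
proof -
  have "(\<lambda>v. deriv_at F (G z) (deriv_at G z v)) = (\<lambda>v. v)"
  proof (rule lifts_same_derivative)
    show "continuous_on UNIV (F \<circ> G)" by (intro C1_map_continuous_on C1_map_compose F G)
    show "(F \<circ> G has_derivative (\<lambda>v. deriv_at F (G z) (deriv_at G z v))) (at z)"
      by (rule deriv_at_compose[OF F G])
    show "continuous_on UNIV (\<lambda>z. z)" by (rule continuous_on_id)
    show "((\<lambda>z. z) has_derivative (\<lambda>v. v)) (at z)" by (rule has_derivative_ident)
  qed (simp add: cover_FG)
  then show ?thesis by (rule fun_cong)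
qed

text \<open>Two points with the same projection differ by a deck translation, and \<open>F\<close>
  precomposed with that translation has the same projection as \<open>F\<close>.\<close>

lemma deriv_cover_cong:
  assumes "cover z = cover w"
  shows "deriv_at F z = deriv_at F w"
proof -
  define c where "c = w - z"
  have "cover z + cover c = cover w" unfolding cover_add[symmetric] c_def by simp
  then have "cover c = 0" using assms by (metis add_cancel_right_right)
  then have c: "cover (y + c) = cover y" for y by (simp add: cover_add)
  have "((\<lambda>y. y + c) has_derivative (\<lambda>v. v)) (at z)" by (auto intro!: derivative_eq_intros)
  from has_derivative_compose[OF this C1_map_has_derivative[OF F]]
  have D: "((\<lambda>y. F (y + c)) has_derivative deriv_at F w) (at z)" by (simp add: c_def)
  show ?thesis
  proof (rule lifts_same_derivative[OF _ _ _ C1_map_has_derivative[OF F] D])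
    show "continuous_on UNIV F" by (rule C1_map_continuous_on[OF F])
    then show "continuous_on UNIV (\<lambda>y. F (y + c))"
      by (rule continuous_on_compose2) (auto intro: continuous_intros)
  qed (simp add: cover_F c)
qed

lemma area_G: "area (deriv_at G z u) (deriv_at G z v) = area u v"
  using area_F[of "G z" "deriv_at G z u" "deriv_at G z v"] by (simp add: deriv_FG)

lemma swap_map: "lifted_map (inv f) G F"
proof
  show "bij (inv f)" using bij by (rule bij_imp_bij_inv)
  show "is_lift F (inv (inv f))" using lift_F bij by (simp add: inv_inv_eq)
qed (use F G lift_G area_G in auto)

lemma deriv_funpow_Suc:
  "deriv_at (F ^^ Suc k) z v = deriv_at F ((F ^^ k) z) (deriv_at (F ^^ k) z v)"
  using frechet_derivative_at[OF deriv_at_compose[OF F C1_map_funpow[OF F]], of k z]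
  by (simp only: funpow.simps) metis

text \<open>For any lift \<open>H\<close> of the inverse, \<open>F\<close> after \<open>H\<close> is
  a translation. The order condition for \<open>F\<close> at \<open>H z\<close> and
  \<open>H w\<close> is therefore the one for \<open>H\<close> at \<open>z\<close> and
  \<open>w\<close>, read backwards.\<close>

lemma ordered_set_inv:
  assumes "ordered_set f M"
  shows "ordered_set (inv f) M"
proof -
  have fM: "f ` M = M" and ord: "\<And>z w. cover z \<in> M \<Longrightarrow> cover w \<in> M \<Longrightarrow> fst z < fst w \<longleftrightarrow> fst (F z) < fst (F w)"
    using assms lift_F unfolding ordered_set_def by auto
  have inv: "inv f ` M = M" using bij fM by (metis bij_is_inj image_inv_f_f)
  have "fst z < fst w \<longleftrightarrow> fst (H z) < fst (H w)"
    if H: "is_lift H (inv f)" and zw: "cover z \<in> M" "cover w \<in> M" for H z w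
  proof -
    have cH: "cover (H y) = inv f (cover y)" for y using H unfolding is_lift_def by blast
    have "cover (F (H y)) = cover y" for y
      using bij by (simp add: cover_F cH bij_is_surj surj_f_inv_f)
    moreover have "continuous_on UNIV (\<lambda>y. F (H y))"
      using H by (intro continuous_on_compose2[OF C1_map_continuous_on[OF F]]) (auto simp: is_lift_def)
    ultimately obtain c where c: "\<And>y. F (H y) = y + c"
      using lifts_differ_by_constant[of "\<lambda>y. F (H y)" "\<lambda>y. y"] continuous_on_id by blast
    have "cover (H z) \<in> M" "cover (H w) \<in> M" using zw inv cH by auto
    from ord[OF this] show ?thesis by (simp add: c)
  qed
  then show ?thesis using assms inv unfolding ordered_set_def by auto
qed

text \<open>Orbits stay in \<open>M\<close>, so the strict order is kept at every step. Negation
  with \<open>z\<close> and \<open>w\<close> exchanged gives the weak order, which also covers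
  points with equal first coordinates.\<close>

lemma ordered_set_funpow:
  assumes M: "ordered_set f M" and zw: "cover z \<in> M" "cover w \<in> M"
  shows "fst ((F ^^ k) z) \<le> fst ((F ^^ k) w) \<longleftrightarrow> fst z \<le> fst w"
proof -
  have fM: "f ` M = M" and ord: "\<And>z w. cover z \<in> M \<Longrightarrow> cover w \<in> M \<Longrightarrow> fst z < fst w \<longleftrightarrow> fst (F z) < fst (F w)"
    using M lift_F unfolding ordered_set_def by auto
  have in_M: "cover ((F ^^ k) y) \<in> M" if "cover y \<in> M" for y k
    by (induction k) (use that fM cover_F in auto)
  have "fst ((F ^^ k) w) < fst ((F ^^ k) z) \<longleftrightarrow> fst w < fst z"
    by (induction k) (use ord[OF in_M in_M] zw in auto)
  then show ?thesis by (simp add: not_less[symmetric])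
qed

end

text \<open>\<open>\<sigma>\<close> is 1 or -1, the sign of the twist. Both kinds of twist map are
  handled at once, and passing to the inverse replaces \<open>\<sigma>\<close> by its
  negative.\<close>

locale lifted_twist = lifted_map +
  fixes \<sigma> :: real
  assumes sgn: "\<sigma> * \<sigma> = 1"
    and twist_F: "\<And>z. 0 < \<sigma> * fst (deriv_at F z (0, 1))"
begin

lemma swap: "lifted_twist (inv f) G F (- \<sigma>)"
proof -
  interpret inv: lifted_map "inv f" G F by (rule swap_map)
  show ?thesis
  proof
  fix z
  \<comment> \<open>\<open>fst w = area w (0, 1)\<close>, and the derivatives are mutually inverse and preserve areas.\<close>
  have "fst (deriv_at G z (0, 1)) = area (deriv_at F (G z) (deriv_at G z (0, 1))) (deriv_at F (G z) (0, 1))"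
    unfolding area_F by (simp add: area_def)
  also have "\<dots> = - fst (deriv_at F (G z) (0, 1))"
    unfolding deriv_FG by (simp add: area_def)
  finally show "0 < - \<sigma> * fst (deriv_at G z (0, 1))" using twist_F[of "G z"] by simp
qed (use sgn in auto)
qed

text \<open>One of the two orders of the first coordinates of \<open>a n\<close> and
  \<open>b n\<close> occurs for infinitely many \<open>n\<close>. All iterates of \<open>F\<close>
  and \<open>G\<close> keep it, so one sign \<open>s\<close> serves every \<open>k\<close>.
  Exchanging the two sequences replaces \<open>v\<close> by \<open>- v\<close>, which accounts for
  the sign -1.\<close>

lemma paratingent_deriv_nonneg:
  assumes M: "ordered_set f M" and v: "v \<in> paratingent_cone M (cover z)"
  shows "\<exists>s\<in>{-1, 1}. \<forall>k. 0 \<le> s * fst (deriv_at (F ^^ k) z v) \<and> 0 \<le> s * fst (deriv_at (G ^^ k) z v)"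
proof -
  interpret inv: lifted_twist "inv f" G F "- \<sigma>" by (rule swap)
  obtain a b \<tau> where aM: "\<And>n. cover (a n) \<in> M" and bM: "\<And>n. cover (b n) \<in> M"
    and a: "a \<longlonglongrightarrow> z" and b: "b \<longlonglongrightarrow> z" and \<tau>: "\<And>n. \<tau> n > 0"
    and lim: "(\<lambda>n. (a n - b n) /\<^sub>R \<tau> n) \<longlonglongrightarrow> v"
    by (rule paratingent_cone_lifts[OF v]) (rule that)
  have lim': "(\<lambda>n. (b n - a n) /\<^sub>R \<tau> n) \<longlonglongrightarrow> - v"
    using tendsto_minus[OF lim] by (simp flip: scaleR_minus_right)
  note le_F = ordered_set_funpow[OF M aM bM] ordered_set_funpow[OF M bM aM]
  note le_G = inv.ordered_set_funpow[OF ordered_set_inv[OF M] aM bM]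
    inv.ordered_set_funpow[OF ordered_set_inv[OF M] bM aM]
  show ?thesis
  proof (cases "\<exists>\<^sub>F n in sequentially. fst (b n) \<le> fst (a n)")
    case True
    have "0 \<le> fst (deriv_at (F ^^ k) z v)" "0 \<le> fst (deriv_at (G ^^ k) z v)" for k
      by (rule deriv_fst_nonneg[OF C1_map_funpow a b \<tau> lim]; use True F G le_F le_G in simp)+
    then show ?thesis by (intro bexI[of _ 1]) auto
  next
    case False
    then have "\<forall>\<^sub>F n in sequentially. fst (a n) \<le> fst (b n)"
      unfolding frequently_def by (auto elim: eventually_mono)
    then have fr: "\<exists>\<^sub>F n in sequentially. fst (a n) \<le> fst (b n)"
      by (rule eventually_frequently[rotated]) simp
    have "0 \<le> fst (deriv_at (F ^^ k) z (- v))" "0 \<le> fst (deriv_at (G ^^ k) z (- v))" for k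
      by (rule deriv_fst_nonneg[OF C1_map_funpow b a \<tau> lim']; use fr F G le_F le_G in simp)+
    then show ?thesis
      using linear_neg[OF deriv_at_linear[OF C1_map_funpow[OF F]]]
        linear_neg[OF deriv_at_linear[OF C1_map_funpow[OF G]]]
      by (intro bexI[of _ "-1"]) auto
  qed
qed

end

section \<open>Dynamics along the invariant curve\<close>

text \<open>\<open>E\<close> lifts a parametrization of \<open>C\<close> by the circle, so only its
  projection is periodic. \<open>inj_fst\<close> combines injectivity of the parametrization with
  the graph property, and \<open>a\<close> is a real representative of the rotation angle.\<close>

locale invariant_curve = lifted_twist +
  fixes E :: "real \<Rightarrow> real \<times> real" and a :: real and C :: "annulus set"
  assumes E: "C1_map E" and tangent_nz: "\<And>t. deriv_at E t 1 \<noteq> 0"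
    and range_E: "range (\<lambda>t. cover (E t)) = C"
    and periodic: "\<And>s t. circle_of s = circle_of t \<Longrightarrow> cover (E s) = cover (E t)"
    and inj_fst: "\<And>s t. circle_of (fst (E s)) = circle_of (fst (E t)) \<Longrightarrow> circle_of s = circle_of t"
    and rotation: "\<And>t. cover (F (E t)) = cover (E (t + a))"
begin

abbreviation tangent :: "real \<Rightarrow> real \<times> real"
  where "tangent t \<equiv> deriv_at E t 1"

lemma E_shift_has_derivative: "((\<lambda>s. E (s + c)) has_derivative deriv_at E (t + c)) (at t)"
proof -
  have "((\<lambda>s. s + c) has_derivative (\<lambda>v. v)) (at t)" by (auto intro!: derivative_eq_intros)
  from has_derivative_compose[OF this C1_map_has_derivative[OF E]] show ?thesis by simp
qed

lemma continuous_E_shift: "continuous_on UNIV (\<lambda>s. E (s + c))"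
  by (rule continuous_on_compose2[OF C1_map_continuous_on[OF E]]) (auto intro: continuous_intros)

lemma tangent_periodic:
  assumes "circle_of s = circle_of t"
  shows "tangent s = tangent t"
proof -
  have "circle_of (y + (t - s)) = circle_of y" for y
    using assms by (simp add: circle_of_eq_iff) (metis Ints_minus minus_diff_eq)
  then have "cover (E y) = cover (E (y + (t - s)))" for y
    using periodic by metis
  from lifts_same_derivative[OF C1_map_continuous_on[OF E] continuous_E_shift this
      C1_map_has_derivative[OF E] E_shift_has_derivative]
  have "deriv_at E s = deriv_at E (s + (t - s))" .
  then show ?thesis by simp
qed

text \<open>By the conjugacy, \<open>F\<close> after \<open>E\<close> and \<open>E\<close> shifted
  by \<open>a\<close> are lifts of the same map into the annulus, so their derivatives
  agree.\<close>

lemma deriv_F_tangent: "deriv_at F (E t) (tangent t) = tangent (t + a)"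
proof -
  have "(\<lambda>v. deriv_at F (E t) (deriv_at E t v)) = deriv_at E (t + a)"
  proof (rule lifts_same_derivative[OF _ continuous_E_shift _ deriv_at_compose[OF F E] E_shift_has_derivative])
    show "continuous_on UNIV (F \<circ> E)" by (intro C1_map_continuous_on C1_map_compose F E)
  qed (simp add: rotation)
  then show ?thesis by (rule fun_cong)
qed

lemma swap_curve: "invariant_curve (inv f) G F (- \<sigma>) E (- a) C"
proof -
  interpret inv: lifted_twist "inv f" G F "- \<sigma>" by (rule swap)
  have rot: "cover (G (E t)) = cover (E (t + - a))" for t
    using rotation[of "t - a"] cover_GF[of "E (t - a)"] by (simp add: cover_G)
  show ?thesis
    by unfold_locales (fact E tangent_nz range_E periodic inj_fst rot)+
qed

lemma fst_E_has_derivative: "((\<lambda>t. fst (E t)) has_real_derivative fst (tangent t)) (at t)"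
proof -
  have "deriv_at E t (h *\<^sub>R 1) = h *\<^sub>R tangent t" for h
    by (rule linear_scale[OF deriv_at_linear[OF E]])
  then have "fst (deriv_at E t h) = fst (tangent t) * h" for h
    by (metis fst_scaleR mult.commute mult_1_right real_scaleR_def)
  then have "(\<lambda>h. fst (deriv_at E t h)) = (*) (fst (tangent t))" by (rule ext)
  then show ?thesis
    using has_derivative_fst[OF C1_map_has_derivative[OF E], of t] by (simp add: has_field_derivative_def)
qed

lemma fst_E_neq:
  assumes "s \<noteq> t" "\<bar>s - t\<bar> < 1"
  shows "fst (E s) \<noteq> fst (E t)"
proof
  assume "fst (E s) = fst (E t)"
  then have "s - t \<in> \<int>" using inj_fst circle_of_eq_iff by metis
  then show False using assms Ints_nonzero_abs_less1 by force
qed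

text \<open>The first coordinate of \<open>E\<close> is injective, hence strictly monotone, on every
  interval of length 1/2. The increment over such an interval is continuous in its left end and
  never zero, so the direction of monotonicity is the same everywhere.\<close>

lemma ex_orientation: "\<exists>c. c \<noteq> 0 \<and> (\<forall>t. 0 \<le> c * fst (tangent t))"
proof -
  define g where "g t = fst (E (t + 1/2)) - fst (E t)" for t
  have nz: "g t \<noteq> 0" for t using fst_E_neq[of "t + 1/2" t] by (simp add: g_def)
  have contE: "continuous_on A (\<lambda>t. fst (E t))" for A
    using C1_map_continuous_on[OF E] by (intro continuous_intros) (rule continuous_on_subset, auto)
  have cont: "continuous_on UNIV g"
    unfolding g_def
    by (intro continuous_on_diff continuous_on_fst continuous_E_shift C1_map_continuous_on[OF E])
  have sgn_g: "0 < g s * g t" for s t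
  proof (rule ccontr)
    assume "\<not> ?thesis"
    then have "g s < 0 \<and> 0 < g t \<or> g t < 0 \<and> 0 < g s"
      using nz[of s] nz[of t] by (auto simp: zero_less_mult_iff linorder_not_less not_less)
    moreover have "connected (range g)" using cont by (intro connected_continuous_image) auto
    ultimately have "0 \<in> range g"
      using connectedD_interval[of "range g" "g s" "g t" 0]
        connectedD_interval[of "range g" "g t" "g s" 0] by auto
    then show False using nz by auto
  qed
  have inc: "0 < g t * (fst (E s) - fst (E t))" if s: "t < s" "s < t + 1/2" for s t
  proof -
    have "inj_on (\<lambda>t. fst (E t)) {t..t + 1/2}"
    proof (intro inj_onI, rule ccontr)
      fix x y assume "x \<in> {t..t + 1/2}" "y \<in> {t..t + 1/2}" "fst (E x) = fst (E y)" "x \<noteq> y"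
      moreover from this have "\<bar>x - y\<bar> < 1" by auto
      ultimately show False using fst_E_neq by blast
    qed
    from continuous_inj_imp_mono[OF s contE this] show ?thesis
      by (auto simp: g_def zero_less_mult_iff)
  qed
  have "0 \<le> g 0 * fst (tangent t)" for t
  proof (rule ccontr)
    assume "\<not> ?thesis"
    then have "g 0 * fst (tangent t) < 0" by simp
    moreover have "((\<lambda>t. g 0 * fst (E t)) has_real_derivative g 0 * fst (tangent t)) (at t)"
      by (intro DERIV_cmult fst_E_has_derivative)
    ultimately obtain d where "d > 0" and d: "\<And>h. h > 0 \<Longrightarrow> h < d \<Longrightarrow> g 0 * fst (E (t + h)) < g 0 * fst (E t)"
      using DERIV_neg_dec_right by blast
    \<comment> \<open>The step is below \<open>d\<close>, where the negative derivative forces a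
      decrease, and below 1/2, where \<open>inc\<close> forces an increase.\<close>
    define h where "h = min d (1/2) / 2"
    have h: "h > 0" "h < d" "h < 1/2" using \<open>d > 0\<close> by (auto simp: h_def)
    have "0 < g t * (fst (E (t + h)) - fst (E t))" using inc[of t "t + h"] h by simp
    then have "0 < g 0 * (fst (E (t + h)) - fst (E t))"
      using sgn_g[of 0 t] by (auto simp: zero_less_mult_iff)
    then show False using d[OF h(1,2)] by (simp add: algebra_simps)
  qed
  then show ?thesis using nz by blast
qed

text \<open>A smoothly embedded curve can be a graph and still have a vertical tangent, as the graph
  of the cube root has at 0. The twist excludes this and makes the weak sign given by the
  orientation strict.\<close>

lemma fst_tangent_sign: "0 < fst (tangent s) * fst (tangent t)"
proof -
  interpret inv: invariant_curve "inv f" G F "- \<sigma>" E "- a" C by (rule swap_curve)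
  obtain c where c: "c \<noteq> 0" and ge: "\<And>t. 0 \<le> c * fst (tangent t)" using ex_orientation by blast
  \<comment> \<open>By the twist, the images of a vertical tangent vector under \<open>f\<close> and its inverse would point to
    opposite sides.\<close>
  have nz: "fst (tangent t) \<noteq> 0" for t
  proof
    assume 0: "fst (tangent t) = 0"
    define y where "y = snd (tangent t)"
    have t: "tangent t = y *\<^sub>R (0, 1)" using 0 by (simp add: prod_eq_iff y_def)
    then have y: "y \<noteq> 0" using tangent_nz[of t] by (auto simp: zero_prod_def)
    define p where "p = fst (deriv_at F (E t) (0, 1))"
    define q where "q = fst (deriv_at G (E t) (0, 1))"
    have "fst (tangent (t + a)) = y * p"
      unfolding deriv_F_tangent[symmetric] t p_def linear_scale[OF deriv_at_linear[OF F]] by simp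
    moreover have "fst (tangent (t + - a)) = y * q"
      unfolding inv.deriv_F_tangent[symmetric] t q_def linear_scale[OF deriv_at_linear[OF G]] by simp
    ultimately have "0 \<le> (c * (y * p)) * (c * (y * q))"
      using ge by (metis mult_nonneg_nonneg)
    then have "0 \<le> (c * y)\<^sup>2 * (p * q)" by (simp add: power2_eq_square algebra_simps)
    moreover have "p * q < 0"
    proof -
      have "0 < (\<sigma> * p) * (- \<sigma> * q)"
        unfolding p_def q_def by (rule mult_pos_pos[OF twist_F inv.twist_F])
      also have "\<dots> = - ((\<sigma> * \<sigma>) * (p * q))" by (simp add: algebra_simps)
      finally show ?thesis by (simp add: sgn)
    qed
    moreover have "(c * y)\<^sup>2 > 0" using c y by simp
    ultimately show False by (meson mult_pos_neg not_less)
  qed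
  have "0 < c * fst (tangent r)" for r
    using ge[of r] nz[of r] c by (simp add: less_le)
  from mult_pos_pos[OF this this] have "0 < (c * fst (tangent s)) * (c * fst (tangent t))" .
  also have "\<dots> = (c * c) * (fst (tangent s) * fst (tangent t))" by (simp add: algebra_simps)
  finally show ?thesis by (rule zero_less_mult_pos) (use c not_real_square_gt_zero in blast)
qed

lemma tangent_bound: "\<exists>B>0. \<forall>t. \<bar>fst (tangent t)\<bar> \<le> B"
proof -
  have "continuous_on {0..1} (\<lambda>t. \<bar>fst (tangent t)\<bar>)"
    unfolding continuous_on_def by (intro ballI tendsto_intros C1_map_deriv_tendsto[OF E])
  then obtain t0 where t0: "\<And>t. t \<in> {0..1} \<Longrightarrow> \<bar>fst (tangent t)\<bar> \<le> \<bar>fst (tangent t0)\<bar>"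
    using continuous_attains_sup[of "{0..1::real}"] by fastforce
  have "\<bar>fst (tangent t)\<bar> \<le> \<bar>fst (tangent t0)\<bar>" for t
    using t0[of "frac t"] tangent_periodic[OF circle_of_frac] by (simp add: frac_lt_1 less_imp_le)
  then show ?thesis using fst_tangent_sign[of t0 t0]
    by (intro exI[of _ "\<bar>fst (tangent t0)\<bar>"]) auto
qed

text \<open>The bound is the minimum over one period of the parameter; it is global because the
  derivative of \<open>F\<close> depends only on the projected point.\<close>

lemma uniform_twist: "\<exists>b>0. \<forall>t. b \<le> \<sigma> * fst (deriv_at F (E t) (0, 1))"
proof -
  have "(E \<longlongrightarrow> E t) (at t within {0..1})" for t
    using C1_map_continuous_on[OF E] by (meson UNIV_I continuous_on_def tendsto_within_subset subset_UNIV)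
  then have "continuous_on {0..1} (\<lambda>t. \<sigma> * fst (deriv_at F (E t) (0, 1)))"
    unfolding continuous_on_def by (intro ballI tendsto_intros C1_map_deriv_tendsto[OF F])
  then obtain t0 where t0: "\<And>t. t \<in> {0..1} \<Longrightarrow>
      \<sigma> * fst (deriv_at F (E t0) (0, 1)) \<le> \<sigma> * fst (deriv_at F (E t) (0, 1))"
    using continuous_attains_inf[of "{0..1::real}"] by fastforce
  have "\<sigma> * fst (deriv_at F (E t0) (0, 1)) \<le> \<sigma> * fst (deriv_at F (E t) (0, 1))" for t
    using t0[of "frac t"] deriv_cover_cong[OF periodic[OF circle_of_frac]]
    by (simp add: frac_lt_1 less_imp_le)
  then show ?thesis using twist_F by blast
qed

lemma cover_funpow_E: "cover ((F ^^ k) (E t)) = cover (E (t + real k * a))"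
proof (induction k)
  case (Suc k)
  then have "cover ((F ^^ Suc k) (E t)) = cover (F (E (t + real k * a)))" by (simp add: cover_F)
  then show ?case by (simp add: rotation algebra_simps)
qed simp

text \<open>In a frame containing the tangent vector, the derivative of \<open>f\<close> along the curve is unipotent,
  and the twist bounds its off-diagonal entry away from 0. So the ratio \<open>q\<close> below changes by
  a definite amount at each step.\<close>

lemma area_tangent_nonneg:
  assumes nonneg: "\<And>k. 0 \<le> fst (deriv_at (F ^^ k) (E t) v) * fst (tangent t)"
  shows "0 \<le> \<sigma> * area (tangent t) v"
proof (rule ccontr)
  define \<delta> where "\<delta> = area (tangent t) v"
  define u where "u k = tangent (t + real k * a)" for k
  define w where "w k = deriv_at (F ^^ k) (E t) v" for k
  define D where "D k = deriv_at F (E (t + real k * a))" for k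
  define q where "q k = fst (w k) / fst (u k)" for k
  assume "\<not> ?thesis"
  then have neg: "\<sigma> * \<delta> < 0" by (simp add: \<delta>_def)
  have lin: "linear (D k)" for k unfolding D_def by (rule deriv_at_linear[OF F])
  have u: "u (Suc k) = D k (u k)" for k
    unfolding u_def D_def deriv_F_tangent by (simp add: algebra_simps)
  have w: "w (Suc k) = D k (w k)" for k
    unfolding w_def D_def deriv_funpow_Suc deriv_cover_cong[OF cover_funpow_E] ..
  have "w 0 = v" by (simp add: w_def id_def[symmetric])
  have area: "area (u k) (w k) = \<delta>" for k
  proof (induction k)
    case 0
    then show ?case by (simp add: u_def \<delta>_def \<open>w 0 = v\<close>)
  next
    case (Suc k)
    then show ?case unfolding u w by (simp add: D_def area_F)
  qed
  obtain B where B: "B > 0" "\<And>t. \<bar>fst (tangent t)\<bar> \<le> B" using tangent_bound by blast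
  obtain b where b: "b > 0" "\<And>t. b \<le> \<sigma> * fst (deriv_at F (E t) (0, 1))" using uniform_twist by blast
  have pos: "0 < fst (u j) * fst (u k)" for j k unfolding u_def by (rule fst_tangent_sign)
  then have nz: "fst (u k) \<noteq> 0" for k by (metis less_irrefl mult_zero_left)
  have q_nonneg: "0 \<le> q k" for k
    using nonneg[of k] pos[of k 0]
    unfolding q_def w_def[symmetric] by (auto simp: u_def zero_le_mult_iff zero_less_mult_iff zero_le_divide_iff)
  \<comment> \<open>This is the guaranteed decrease of \<open>q\<close> per step: the twist
    contributes at least \<open>b\<close>, and the product of two first coordinates of tangent
    vectors is at most \<open>B * B\<close>. It is positive because
    \<open>\<sigma> * \<delta>\<close> is negative.\<close>
  define c where "c = - (\<sigma> * \<delta> * b) / (B * B)"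
  have c: "c > 0" unfolding c_def using neg b B by (simp add: divide_neg_pos mult_neg_pos)
  have step: "q (Suc k) \<le> q k - c" for k
  proof -
    let ?P = "fst (u (Suc k)) * fst (u k)" and ?d = "fst (D k (0, 1))"
    \<comment> \<open>In this combination the first coordinates cancel and the second coordinate is
      the conserved area \<open>\<delta>\<close>. One step thus applies the derivative of
      \<open>F\<close> to a vertical vector, where the twist is known.\<close>
    have "fst (u k) *\<^sub>R w k - fst (w k) *\<^sub>R u k = \<delta> *\<^sub>R (0, 1)"
      using area[of k] by (simp add: area_def prod_eq_iff algebra_simps)
    then have "fst (u k) *\<^sub>R w (Suc k) - fst (w k) *\<^sub>R u (Suc k) = \<delta> *\<^sub>R D k (0, 1)"
      unfolding u w by (metis linear_diff[OF lin] linear_scale[OF lin])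
    from arg_cong[OF this, of fst]
    have "fst (u k) * fst (w (Suc k)) - fst (w k) * fst (u (Suc k)) = \<delta> * ?d" by simp
    then have q: "q (Suc k) - q k = \<delta> * ?d / ?P"
      using nz by (simp add: q_def field_simps)
    have "\<delta> * ?d = (\<sigma> * \<sigma>) * (\<delta> * ?d)" by (simp add: sgn)
    also have "\<dots> = (\<sigma> * \<delta>) * (\<sigma> * ?d)" by (simp add: algebra_simps)
    also have "\<dots> \<le> (\<sigma> * \<delta>) * b"
      unfolding D_def by (rule mult_left_mono_neg[OF b(2)]) (use neg in simp)
    finally have "\<delta> * ?d / ?P \<le> (\<sigma> * \<delta> * b) / ?P"
      using pos by (simp add: divide_right_mono less_imp_le)
    also have "\<dots> \<le> (\<sigma> * \<delta> * b) / (B * B)"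
    proof (rule divide_left_mono_neg)
      have "?P = \<bar>fst (u (Suc k))\<bar> * \<bar>fst (u k)\<bar>" using pos[of "Suc k" k] by (simp flip: abs_mult)
      also have "\<dots> \<le> B * B" unfolding u_def using B by (intro mult_mono) auto
      finally show "?P \<le> B * B" .
      show "\<sigma> * \<delta> * b \<le> 0" using neg b by (simp add: mult_nonpos_nonneg)
      show "0 < ?P * (B * B)" using B pos by simp
    qed
    finally show ?thesis using q by (simp add: c_def)
  qed
  have "q k \<le> q 0 - real k * c" for k
  proof (induction k)
    case (Suc k)
    then show ?case using step[of k] by (simp add: algebra_simps)
  qed simp
  \<comment> \<open>A decrease by \<open>c\<close> at each step makes \<open>q\<close> negative
    after finitely many steps, against \<open>q_nonneg\<close>.\<close>
  moreover obtain k where "q 0 < real k * c" using reals_Archimedean3[OF c] by blast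
  ultimately have "q k < 0" by (metis diff_less_0_iff_less le_less_trans)
  then show False using q_nonneg[of k] by simp
qed

end

section \<open>Tangency on the curve and passage to a neighbourhood\<close>

context invariant_curve
begin

text \<open>A vector of zero area with the nonzero tangent vector is a multiple of it; running along
  \<open>E\<close> at the corresponding constant speed realizes it as a velocity.\<close>

lemma area_zero_tangent_space:
  assumes "area (tangent t) v = 0"
  shows "v \<in> tangent_space C (cover (E t))"
proof -
  define l where "l = fst v / fst (tangent t)"
  have "fst (tangent t) \<noteq> 0" using fst_tangent_sign[of t t] by auto
  then have v: "v = l *\<^sub>R tangent t"
    using assms by (simp add: l_def area_def prod_eq_iff field_simps)
  have d: "((\<lambda>s. t + s *\<^sub>R l) has_derivative (\<lambda>s. s *\<^sub>R l)) (at 0)"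
    by (auto intro!: derivative_eq_intros)
  have "deriv_at E t (s *\<^sub>R l) = s *\<^sub>R v" for s
    using linear_scale[OF deriv_at_linear[OF E], of t "s * l" 1] by (simp add: v)
  then have "((E \<circ> (\<lambda>s. t + s *\<^sub>R l)) has_vector_derivative v) (at 0)"
    using has_derivative_compose[OF d C1_map_has_derivative[OF E]]
    by (simp add: has_vector_derivative_def o_def)
  moreover have "C1_map (E \<circ> (\<lambda>s. t + s *\<^sub>R l))"
    by (rule C1_map_compose[OF E C1_map_affine])
  ultimately show ?thesis
    unfolding tangent_space_def using range_E by (intro CollectI exI[of _ "E \<circ> (\<lambda>s. t + s *\<^sub>R l)"]) auto
qed

text \<open>The future bounds \<open>\<sigma>\<close> times the area from below by 0. The past does
  the same with the opposite twist sign and the same tangent vector, so the area vanishes.\<close>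

lemma one_sided_orbit_tangent:
  assumes s: "s \<in> {-1, 1}"
    and nonneg_F: "\<And>k. 0 \<le> s * fst (deriv_at (F ^^ k) (E t) v)"
    and nonneg_G: "\<And>k. 0 \<le> s * fst (deriv_at (G ^^ k) (E t) v)"
  shows "v \<in> tangent_space C (cover (E t))"
proof (rule area_zero_tangent_space)
  interpret inv: invariant_curve "inv f" G F "- \<sigma>" E "- a" C by (rule swap_curve)
  \<comment> \<open>Scaling \<open>v\<close> by \<open>l\<close> aligns the sign \<open>s\<close>
    with the orientation of the curve, since the products in question become \<open>s\<close> times
    the given derivative times a square.\<close>
  define l where "l = s * fst (tangent t)"
  have l: "l \<noteq> 0" using fst_tangent_sign[of t t] s by (auto simp: l_def)
  have scaled: "0 \<le> fst (deriv_at (H ^^ k) (E t) (l *\<^sub>R v)) * fst (tangent t)"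
    if H: "C1_map H" and nonneg: "0 \<le> s * fst (deriv_at (H ^^ k) (E t) v)" for H :: "real \<times> real \<Rightarrow> real \<times> real" and k
  proof -
    have "0 \<le> (s * fst (deriv_at (H ^^ k) (E t) v)) * (fst (tangent t) * fst (tangent t))"
      by (rule mult_nonneg_nonneg[OF nonneg zero_le_square])
    then show ?thesis
      by (simp add: linear_scale[OF deriv_at_linear[OF C1_map_funpow[OF H]]] l_def algebra_simps)
  qed
  have "0 \<le> \<sigma> * area (tangent t) (l *\<^sub>R v)"
    by (rule area_tangent_nonneg[OF scaled[OF F nonneg_F]])
  moreover have "0 \<le> - \<sigma> * area (tangent t) (l *\<^sub>R v)"
    by (rule inv.area_tangent_nonneg[OF scaled[OF G nonneg_G]])
  ultimately have "\<sigma> * area (tangent t) (l *\<^sub>R v) = 0" by simp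
  then have "(\<sigma> * \<sigma>) * (l * area (tangent t) v) = 0" by (simp add: area_def algebra_simps)
  then show "area (tangent t) v = 0" using l sgn by simp
qed

text \<open>Otherwise there are unit paratingent vectors outside \<open>O'\<close> at points tending
  to \<open>C\<close>. A subsequence converges to a unit vector at a point of \<open>C\<close> that
  inherits the sign conditions and so is tangent. It then lies in the open set \<open>O'\<close>,
  which the sequence avoids.\<close>

lemma paratingent_near_curve:
  assumes "open O'" "unit_tangent_bundle C \<subseteq> O'"
  shows "\<exists>U. open U \<and> C \<subseteq> U \<and>
    (\<forall>M x. ordered_set f M \<and> M \<subseteq> U \<and> x \<in> M \<longrightarrow> {x} \<times> unit_paratingent_cone M x \<subseteq> O')"
proof (rule ccontr)
  assume contra: "\<not> ?thesis"
  define U where "U n = (\<Union>c\<in>C. ball c (inverse (real (Suc n))))" for n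
  have U: "open (U n)" "C \<subseteq> U n" for n unfolding U_def by auto
  have "\<exists>M x v. ordered_set f M \<and> M \<subseteq> U n \<and> x \<in> M \<and> v \<in> unit_paratingent_cone M x \<and> (x, v) \<notin> O'" for n
    using contra U[of n] by fast
  then obtain M x v where M: "\<And>n. ordered_set f (M n)" "\<And>n. M n \<subseteq> U n" and x: "\<And>n. x n \<in> M n"
    and v: "\<And>n. v n \<in> unit_paratingent_cone (M n) (x n)" and notin: "\<And>n. (x n, v n) \<notin> O'"
    by metis
  have "\<exists>t\<in>{0..1}. dist (cover (E t)) (x n) < inverse (real (Suc n))" for n
  proof -
    obtain s where "dist (cover (E s)) (x n) < inverse (real (Suc n))"
      using x[of n] M(2)[of n] range_E by (auto simp: U_def)
    then show ?thesis
      using periodic[OF circle_of_frac[of s]] by (intro bexI[of _ "frac s"]) (auto simp: frac_lt_1 less_imp_le)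
  qed
  then obtain t where t: "\<And>n. t n \<in> {0..1}"
    and tx: "\<And>n. dist (cover (E (t n))) (x n) < inverse (real (Suc n))" by metis
  have "norm (v n) = 1" for n using v[of n] by (simp add: unit_paratingent_cone_def)
  then have tv: "(t n, v n) \<in> {0..1} \<times> sphere 0 1" for n using t by auto
  have compact: "seq_compact ({0..1::real} \<times> sphere (0::real \<times> real) 1)"
    by (intro compact_imp_seq_compact compact_Times) auto
  obtain l r where l: "l \<in> {0..1} \<times> sphere 0 1" and r: "strict_mono (r :: nat \<Rightarrow> nat)"
    and "((\<lambda>n. (t n, v n)) \<circ> r) \<longlonglongrightarrow> l"
    by (rule seq_compactE[OF compact allI[OF tv]]) (rule that)
  then have lim: "(\<lambda>n. t (r n)) \<longlonglongrightarrow> fst l" "(\<lambda>n. v (r n)) \<longlonglongrightarrow> snd l"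
    using tendsto_fst tendsto_snd by (force simp: o_def)+
  define t0 where "t0 = fst l"
  define v0 where "v0 = snd l"
  have E_lim: "(\<lambda>n. cover (E (t (r n)))) \<longlonglongrightarrow> cover (E t0)"
    using lim(1) continuous_on_tendsto_compose[OF C1_map_continuous_on[OF E], of "\<lambda>n. t (r n)"]
    by (intro tendsto_cover) (auto simp: t0_def)
  have dist_lim: "(\<lambda>n. dist (cover (E (t (r n)))) (x (r n))) \<longlonglongrightarrow> 0"
  proof (rule LIMSEQ_subseq_LIMSEQ[OF _ r, unfolded o_def])
    show "(\<lambda>n. dist (cover (E (t n))) (x n)) \<longlonglongrightarrow> 0"
      by (rule Lim_null_comparison[OF always_eventually LIMSEQ_inverse_real_of_nat])
        (use tx in \<open>auto simp: less_imp_le\<close>)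
  qed
  have x_lim: "(\<lambda>n. x (r n)) \<longlonglongrightarrow> cover (E t0)"
  proof (rule iffD2[OF tendsto_dist_iff], rule Lim_null_comparison[OF always_eventually tendsto_add_zero[OF dist_lim]], rule allI)
    show "(\<lambda>n. dist (cover (E (t (r n)))) (cover (E t0))) \<longlonglongrightarrow> 0"
      by (rule iffD1[OF tendsto_dist_iff E_lim])
    show "norm (dist (x (r n)) (cover (E t0))) \<le>
        dist (cover (E (t (r n)))) (x (r n)) + dist (cover (E (t (r n)))) (cover (E t0))" for n
      using dist_triangle3[of "x (r n)" "cover (E t0)" "cover (E (t (r n)))"] by simp
  qed
  \<comment> \<open>These lifts of the points \<open>x (r n)\<close> converge to \<open>E t0\<close>
    itself, so derivatives of the iterates at them can be passed to the limit.\<close>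
  define z where "z n = E t0 + annulus_lift (x (r n) - cover (E t0))" for n
  have z_lim: "z \<longlonglongrightarrow> E t0" unfolding z_def by (rule tendsto_lift_near[OF x_lim])
  have cover_z: "cover (z n) = x (r n)" for n
    unfolding z_def cover_add cover_annulus_lift by simp
  have "\<exists>s\<in>{-1, 1}. \<forall>k. 0 \<le> s * fst (deriv_at (F ^^ k) (z n) (v (r n))) \<and>
      0 \<le> s * fst (deriv_at (G ^^ k) (z n) (v (r n)))" for n
    using v[of "r n"] by (intro paratingent_deriv_nonneg[OF M(1)[of "r n"]])
      (simp add: cover_z unit_paratingent_cone_def)
  then obtain s where s: "\<And>n. s n \<in> {-1, 1}"
    and F_ge: "\<And>n k. 0 \<le> s n * fst (deriv_at (F ^^ k) (z n) (v (r n)))"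
    and G_ge: "\<And>n k. 0 \<le> s n * fst (deriv_at (G ^^ k) (z n) (v (r n)))" by metis
  \<comment> \<open>The sign may depend on \<open>n\<close>; a further subsequence has convergent
    signs, with limit again 1 or -1.\<close>
  have signs: "seq_compact {-1, 1 :: real}" by (intro compact_imp_seq_compact) auto
  obtain s0 q where s0: "s0 \<in> {-1, 1}" and q: "strict_mono (q :: nat \<Rightarrow> nat)" and "(s \<circ> q) \<longlonglongrightarrow> s0"
    by (rule seq_compactE[OF signs allI[OF s]]) (rule that)
  then have s_lim: "(\<lambda>n. s (q n)) \<longlonglongrightarrow> s0" by (simp add: o_def)
  have zq: "(\<lambda>n. z (q n)) \<longlonglongrightarrow> E t0" and vq: "(\<lambda>n. v (r (q n))) \<longlonglongrightarrow> v0"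
    using LIMSEQ_subseq_LIMSEQ[OF z_lim q] LIMSEQ_subseq_LIMSEQ[OF lim(2) q] by (auto simp: o_def v0_def)
  \<comment> \<open>Here \<open>k\<close> stays fixed while \<open>n\<close> tends to infinity, so
    continuity of the derivative of each single iterate gives the inequality.\<close>
  have lim_ge: "0 \<le> s0 * fst (deriv_at (H ^^ k) (E t0) v0)"
    if "C1_map H" "\<And>n. 0 \<le> s n * fst (deriv_at (H ^^ k) (z n) (v (r n)))" for H :: "real \<times> real \<Rightarrow> real \<times> real" and k
    by (rule LIMSEQ_le_const[OF tendsto_mult[OF s_lim
        tendsto_fst[OF C1_map_deriv_tendsto[OF C1_map_funpow[OF that(1)] zq vq]]]])
      (use that(2) in blast)
  have "v0 \<in> tangent_space C (cover (E t0))"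
    by (rule one_sided_orbit_tangent[OF s0]) (use lim_ge F G F_ge G_ge in blast)+
  moreover have "norm v0 = 1" using l by (auto simp: v0_def)
  ultimately have "(cover (E t0), v0) \<in> O'"
    using assms(2) range_E by (auto simp: unit_tangent_bundle_def)
  moreover have "(\<lambda>n. (x (r n), v (r n))) \<longlonglongrightarrow> (cover (E t0), v0)"
    using x_lim lim(2) unfolding v0_def by (rule tendsto_Pair)
  ultimately have "\<forall>\<^sub>F n in sequentially. (x (r n), v (r n)) \<in> O'"
    using assms(1) topological_tendstoD by blast
  then show False using notin by simp
qed

end

section \<open>From the twist hypotheses to the lifted setting\<close>

text \<open>Monotonicity along verticals rules out a negative derivative, and differentiability of
  the inverse rules out a zero one.\<close>

lemma positive_twist_deriv_pos:
  assumes f: "positive_twist_map f" and F: "C1_map F" "is_lift F f"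
  shows "0 < fst (deriv_at F z (0, 1))"
proof -
  define \<theta> where "\<theta> = fst z"
  define g where "g r = fst (F (\<theta>, r))" for r
  define D where "D = fst (deriv_at F z (0, 1))"
  have diffeo: "C1_diffeo g" and mono: "strict_mono g"
    using f F unfolding positive_twist_map_def g_def by blast+
  have "((\<lambda>r. (\<theta>, r)) has_derivative (\<lambda>h. (0, h))) (at (snd z))"
    by (auto intro!: derivative_eq_intros)
  from has_derivative_fst[OF has_derivative_compose[OF this C1_map_has_derivative[OF F(1)]]]
  have "(g has_derivative (\<lambda>h. fst (deriv_at F z (0, h)))) (at (snd z))"
    by (simp add: g_def[abs_def] \<theta>_def)
  moreover have "fst (deriv_at F z (0, h)) = D * h" for h
    using linear_scale[OF deriv_at_linear[OF F(1)], of z h "(0, 1)"] by (simp add: D_def)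
  ultimately have der: "(g has_real_derivative D) (at (snd z))"
    by (simp add: has_field_derivative_def)
  have "\<not> D < 0"
  proof
    assume "D < 0"
    then obtain d where "d > 0" "\<And>h. 0 < h \<Longrightarrow> h < d \<Longrightarrow> g (snd z + h) < g (snd z)"
      using DERIV_neg_dec_right[OF der] by blast
    then have "g (snd z + d / 2) < g (snd z)" by simp
    then show False using strict_monoD[OF mono, of "snd z" "snd z + d / 2"] \<open>d > 0\<close> by simp
  qed
  moreover have "D \<noteq> 0"
  proof
    assume "D = 0"
    then have "(g has_derivative (\<lambda>h. 0)) (at (snd z))"
      using der by (simp add: has_field_derivative_def lambda_zero)
    moreover have g: "C1_map (inv g)" "bij g" using diffeo by (auto simp: C1_diffeo_def)
    \<comment> \<open>With \<open>D = 0\<close> the chain rule gives the identity a constant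
      function as its derivative, although that derivative takes different values at 0 and
      1.\<close>
    ultimately have "((\<lambda>r. inv g (g r)) has_derivative (\<lambda>h. deriv_at (inv g) (g (snd z)) 0)) (at (snd z))"
      using has_derivative_compose C1_map_has_derivative by blast
    moreover have "inv g (g r) = r" for r using g by (simp add: bij_is_inj)
    ultimately have "((\<lambda>r. r) has_derivative (\<lambda>h. deriv_at (inv g) (g (snd z)) 0)) (at (snd z))" by simp
    then have "(\<lambda>h. deriv_at (inv g) (g (snd z)) 0) = (\<lambda>h. h)"
      by (rule has_derivative_unique[OF _ has_derivative_ident])
    from fun_cong[OF this, of 0] fun_cong[OF this, of 1] show False by simp
  qed
  ultimately show ?thesis by (simp add: D_def)
qed

lemma ex_lifted_twist:
  assumes twist: "twist_map f" and exact: "exact_symplectic f"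
  obtains F G \<sigma> where "lifted_twist f F G \<sigma>"
proof -
  have diffeo: "bij f" "annulus_C1_map f" "annulus_C1_map (inv f)"
    using twist inv_inv_eq[of f]
    unfolding twist_map_def negative_twist_map_def positive_twist_map_def annulus_C1_diffeo_def by auto
  then obtain F G where F: "is_lift F f" "C1_map F" and G: "is_lift G (inv f)" "C1_map G"
    unfolding annulus_C1_map_def by blast
  obtain S where S: "\<And>z. ((\<lambda>w. S (cover w)) has_derivative
      (\<lambda>h. snd (F z) * fst (deriv_at F z h) - snd z * fst h)) (at z)"
    using exact F(1) unfolding exact_symplectic_def by blast
  have area: "area (deriv_at F z u) (deriv_at F z v) = area u v" for z u v
    by (rule exact_area_preserving[OF F(2) S])
  interpret lifted_map f F G
    by unfold_locales (fact diffeo F G area)+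
  from twist show ?thesis
    unfolding twist_map_def
  proof
    assume "positive_twist_map f"
    then have "lifted_twist f F G 1"
      by unfold_locales (simp_all add: positive_twist_deriv_pos[OF _ F lift_F])
    then show ?thesis by (rule that)
  next
    assume "negative_twist_map f"
    then have pos: "positive_twist_map (inv f)" by (simp add: negative_twist_map_def)
    interpret inv: lifted_map "inv f" G F by (rule swap_map)
    \<comment> \<open>A negative twist map is treated through its inverse, lifted by
      \<open>G\<close> with sign 1; \<open>swap\<close> then returns to \<open>f\<close> with sign
      -1.\<close>
    interpret inv: lifted_twist "inv f" G F 1
      by unfold_locales (simp_all add: positive_twist_deriv_pos[OF pos G lift_G])
    show ?thesis using that inv.swap inv_inv_eq[OF diffeo(1)] by metis
  qed
qed

theorem theorem6:
  fixes f :: "annulus \<Rightarrow> annulus"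
    and C :: "annulus set"
    and W :: "(annulus \<times> (real \<times> real)) set"
  assumes "twist_map f" and "exact_symplectic f"
    and "C1_closed_curve C" and "is_graph C" and "f ` C = C"
    and "C1_conjugate_to_rotation f C"
    and "W \<subseteq> unit_tangent_annulus"
    and "\<exists>U. openin (top_of_set unit_tangent_annulus) U \<and> unit_tangent_bundle C \<subseteq> U \<and> U \<subseteq> W"
  shows "\<exists>V. (\<exists>U. open U \<and> C \<subseteq> U \<and> U \<subseteq> V) \<and>
    (\<forall>M. aubry_mather_set f M \<and> M \<subseteq> V \<longrightarrow>
      (\<forall>x\<in>M. {x} \<times> unit_paratingent_cone M x \<subseteq> W))"
proof -
  obtain F G \<sigma> where "lifted_twist f F G \<sigma>" using ex_lifted_twist assms(1,2) by blast
  then interpret lifted_twist f F G \<sigma> .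
  obtain e \<alpha> where e: "C1_embedding e" "range e = C" and rot: "\<And>t. f (e t) = e (t + \<alpha>)"
    using assms(6) unfolding C1_conjugate_to_rotation_def by blast
  obtain a where \<alpha>: "\<alpha> = circle_of a" using ex_circle_of by blast
  obtain E where E: "\<And>t. cover (E t) = e (circle_of t)" "C1_map E"
    and nz: "\<And>t. vector_derivative E (at t) \<noteq> 0" and inj: "inj e"
    using e(1) unfolding C1_embedding_def by blast
  obtain \<gamma> where \<gamma>: "C = range (\<lambda>\<theta>. (\<theta>, \<gamma> \<theta>))" using assms(4) unfolding is_graph_def by blast
  interpret invariant_curve f F G \<sigma> E a C
  proof
    show "deriv_at E t 1 \<noteq> 0" for t
      using nz[of t] frechet_derivative_eq_vector_derivative[of E t]
        differentiableI[OF C1_map_has_derivative[OF E(2), of t]] by simp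
    have "range (\<lambda>t. cover (E t)) = e ` range circle_of" by (auto simp: E)
    then show "range (\<lambda>t. cover (E t)) = C" using ex_circle_of e(2) by fastforce
    show "circle_of s = circle_of t" if "circle_of (fst (E s)) = circle_of (fst (E t))" for s t
    proof -
      \<comment> \<open>Points of a graph are determined by their angle, so equal angles give equal
        points of \<open>C\<close>, and injectivity of \<open>e\<close> gives equal
        parameters.\<close>
      have "y = (fst y, \<gamma> (fst y))" if "y \<in> C" for y using that \<gamma> by auto
      moreover have "cover (E s) \<in> C" "cover (E t) \<in> C" using e(2) by (auto simp: E)
      moreover have "fst (cover (E s)) = fst (cover (E t))" using that by (simp add: cover_def)
      ultimately have "cover (E s) = cover (E t)" by metis
      then show ?thesis using inj by (simp add: E inj_eq)
    qed
    show "cover (F (E t)) = cover (E (t + a))" for t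
      by (simp add: cover_F E rot \<alpha> circle_of_add)
  qed (simp_all add: E)
  obtain N where N: "openin (top_of_set unit_tangent_annulus) N" "unit_tangent_bundle C \<subseteq> N" "N \<subseteq> W"
    using assms(8) by blast
  \<comment> \<open>The relatively open set is the trace of an open set \<open>O'\<close> of the
    full product. Unit paratingent vectors lie in \<open>unit_tangent_annulus\<close>, so membership
    in \<open>O'\<close> brings them back into \<open>N\<close> and hence into
    \<open>W\<close>.\<close>
  then obtain O' where O': "open O'" "N = unit_tangent_annulus \<inter> O'" by (auto simp: openin_open)
  with N(2) have "unit_tangent_bundle C \<subseteq> O'" by blast
  from paratingent_near_curve[OF O'(1) this] obtain U where U: "open U" "C \<subseteq> U"
    and par: "\<forall>M x. ordered_set f M \<and> M \<subseteq> U \<and> x \<in> M \<longrightarrow> {x} \<times> unit_paratingent_cone M x \<subseteq> O'"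
    by (elim exE conjE) (rule that)
  have "{x} \<times> unit_paratingent_cone M x \<subseteq> W" if "aubry_mather_set f M" "M \<subseteq> U" "x \<in> M" for M x
  proof -
    have "{x} \<times> unit_paratingent_cone M x \<subseteq> unit_tangent_annulus"
      by (auto simp: unit_tangent_annulus_def unit_paratingent_cone_def)
    moreover have "{x} \<times> unit_paratingent_cone M x \<subseteq> O'"
      using that by (intro par[rule_format] conjI) (auto simp: aubry_mather_set_def)
    ultimately show ?thesis using N(3) O'(2) by blast
  qed
  then show ?thesis using U by (intro exI[of _ U]) blast
qed

end
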